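(* Let $(M,d)$ be a metric space, $k\ge1$ a real number, and let $S\subset M$ be an $(\mathcal{H}^k,1)$-rectifiable and $\mathcal{H}^k$-measurable set such that $\mathcal{H}^k(S)<+\infty$. Then for $\mathcal{H}^k$-almost every $q\in S$ $$2\le\liminf_{r\to0^+}\frac{\mathcal{H}^k(S\cap B(q,r))}{r^k}\le\limsup_{r\to0^+}\frac{\mathcal{H}^k(S\cap B(q,r))}{r^k}\le 2^k,$$ where $B(q,r)$ is the ball of center $q$ and radius $r$ in $(M,d)$.
   Context: Let $(M,d)$ be a metric space and $k\ge1$ real. A continuous curve $\gamma:[a,b]\to M$ is m-differentiable of degree $k$ at $t\in[a,b]$ if $\lim_{s\to0,\ t+s\in[a,b]} d(\gamma(t+s),\gamma(t))/|s|^{1/k}$ exists and is finite; then $\mathrm{meas}^k_t(\gamma)$ denotes the $k$-th power of this limit. The curve $\gamma$ is of class m-$\mathcal{C}^1_k$ if it is m-differentiable of degree $k$ at every $t\in[a,b]$ and $t\mapsto\mathrm{meas}^k_t(\gamma)$ is continuous. A subset $S\subset M$ is $(\mathcal{H}^k,1)$-rectifiable if there is a countable family of m-$\mathcal{C}^1_k$ curves $\gamma_i:I_i\to M$, $i\in\mathbb{N}$, each $I_i$ a closed interval of $\mathbb{R}$, such that $\mathcal{H}^k\big(S\setminus\bigcup_{i\in\mathbb{N}}\gamma_i(I_i)\big)=0$. The Hausdorff measure is taken without normalizing constant: $\mathcal{H}^k(A)=\lim_{\epsilon\to0^+}\inf\{\sum_{i\ge1}(\mathrm{diam}\,S_i)^k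 : A\subset\bigcup_i S_i,\ \mathrm{diam}\,S_i\le\epsilon,\ S_i\text{ closed}\}$. *)

theory Defs
  imports "HOL-Analysis.Analysis"
begin

text \<open>Boundedness is required explicitly because \<^const>\<open>diameter\<close> is real-valued and unspecified
  on unbounded sets. If there is no countable cover, the infimum is \<open>\<infinity>\<close>.\<close>

definition hausdorff_premeasure :: "real \<Rightarrow> real \<Rightarrow> 'a::metric_space set \<Rightarrow> ennreal" where
  "hausdorff_premeasure k \<epsilon> A =
     Inf {(\<Sum>i. ennreal (diameter (C i) powr k)) | C :: nat \<Rightarrow> 'a set.
       A \<subseteq> (\<Union>i. C i) \<and> (\<forall>i. closed (C i) \<and> bounded (C i) \<and> diameter (C i) \<le> \<epsilon>)}"

text \<open>The unnormalized \<open>k\<close>-dimensional Hausdorff measure, as an outer measure on all subsets.\<close>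

definition hausdorff_measure :: "real \<Rightarrow> 'a::metric_space set \<Rightarrow> ennreal" where
  "hausdorff_measure k A = Lim (at_right 0) (\<lambda>\<epsilon>. hausdorff_premeasure k \<epsilon> A)"

lemma hausdorff_premeasure_antimono:
  fixes A :: "'a::metric_space set"
  assumes "\<epsilon> \<le> \<delta>"
  shows "hausdorff_premeasure k \<delta> A \<le> hausdorff_premeasure k \<epsilon> A"
  unfolding hausdorff_premeasure_def
proof (rule Inf_superset_mono, safe)
  fix C :: "nat \<Rightarrow> 'a set"
  assume C: "A \<subseteq> (\<Union>i. C i)" "\<forall>i. closed (C i) \<and> bounded (C i) \<and> diameter (C i) \<le> \<epsilon>"
  then have "\<forall>i. closed (C i) \<and> bounded (C i) \<and> diameter (C i) \<le> \<delta>"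
    using assms order_trans by blast
  with C(1) show "\<exists>D. (\<Sum>i. ennreal (diameter (C i) powr k)) = (\<Sum>i. ennreal (diameter (D i) powr k)) \<and>
      A \<subseteq> (\<Union>i. D i) \<and> (\<forall>i. closed (D i) \<and> bounded (D i) \<and> diameter (D i) \<le> \<delta>)"
    by blast
qed

lemma hausdorff_measure_tendsto_SUP:
  "((\<lambda>\<epsilon>. hausdorff_premeasure k \<epsilon> A) \<longlongrightarrow> (SUP \<epsilon>\<in>{0<..}. hausdorff_premeasure k \<epsilon> A)) (at_right 0)"
proof (rule increasing_tendsto)
  show "\<forall>\<^sub>F \<epsilon> in at_right 0. hausdorff_premeasure k \<epsilon> A \<le> (SUP \<epsilon>\<in>{0<..}. hausdorff_premeasure k \<epsilon> A)"
    by (rule eventually_mono[OF eventually_at_right_less[of 0]]) (rule SUP_upper, simp)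
next
  fix x assume "x < (SUP \<epsilon>\<in>{0<..}. hausdorff_premeasure k \<epsilon> A)"
  then obtain \<delta> where \<delta>: "\<delta> > 0" "x < hausdorff_premeasure k \<delta> A"
    by (auto simp: less_SUP_iff)
  have "x < hausdorff_premeasure k \<epsilon> A" if "\<epsilon> < \<delta>" for \<epsilon>
    using \<delta>(2) hausdorff_premeasure_antimono[of \<epsilon> \<delta> k A] that by auto
  with \<delta>(1) show "\<forall>\<^sub>F \<epsilon> in at_right 0. x < hausdorff_premeasure k \<epsilon> A"
    unfolding eventually_at_right_field by blast
qed

lemma hausdorff_measure_eq_SUP:
  "hausdorff_measure k A = (SUP \<epsilon>\<in>{0<..}. hausdorff_premeasure k \<epsilon> A)"
  unfolding hausdorff_measure_def
  by (rule tendsto_Lim[OF _ hausdorff_measure_tendsto_SUP]) simp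

text \<open>Measurability is Caratheodory measurability with respect to this outer measure.\<close>

definition hausdorff_measurable :: "real \<Rightarrow> 'a::metric_space set \<Rightarrow> bool" where
  "hausdorff_measurable k S \<longleftrightarrow> S \<in> lambda_system UNIV UNIV (hausdorff_measure k)"

definition m_quotient :: "real \<Rightarrow> (real \<Rightarrow> 'a::metric_space) \<Rightarrow> real \<Rightarrow> real \<Rightarrow> real" where
  "m_quotient k \<gamma> t s = dist (\<gamma> (t + s)) (\<gamma> t) / \<bar>s\<bar> powr (1 / k)"

definition m_differentiable :: "real \<Rightarrow> real \<Rightarrow> real \<Rightarrow> (real \<Rightarrow> 'a::metric_space) \<Rightarrow> real \<Rightarrow> bool" where
  "m_differentiable k a b \<gamma> t \<longleftrightarrow>
     (\<exists>L. (m_quotient k \<gamma> t \<longlongrightarrow> L) (at 0 within {s. t + s \<in> {a..b}}))"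

definition meas :: "real \<Rightarrow> real \<Rightarrow> real \<Rightarrow> (real \<Rightarrow> 'a::metric_space) \<Rightarrow> real \<Rightarrow> real" where
  "meas k a b \<gamma> t = (Lim (at 0 within {s. t + s \<in> {a..b}}) (m_quotient k \<gamma> t)) powr k"

text \<open>Only the values of \<open>\<gamma>\<close> on \<open>{a..b}\<close> matter.\<close>

definition m_C1 :: "real \<Rightarrow> real \<Rightarrow> real \<Rightarrow> (real \<Rightarrow> 'a::metric_space) \<Rightarrow> bool" where
  "m_C1 k a b \<gamma> \<longleftrightarrow>
     continuous_on {a..b} \<gamma> \<and>
     (\<forall>t\<in>{a..b}. m_differentiable k a b \<gamma> t) \<and>
     continuous_on {a..b} (meas k a b \<gamma>)"

definition rectifiable_Hk1 :: "real \<Rightarrow> 'a::metric_space set \<Rightarrow> bool" where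
  "rectifiable_Hk1 k S \<longleftrightarrow>
     (\<exists>(\<gamma> :: nat \<Rightarrow> real \<Rightarrow> 'a) a b.
        (\<forall>i. a i < b i \<and> m_C1 k (a i) (b i) (\<gamma> i)) \<and>
        hausdorff_measure k (S - (\<Union>i. \<gamma> i ` {a i..b i})) = 0)"

end

theory Submission
  imports Defs
begin

text \<open>The upper bound holds for every set of finite measure: if \<open>A\<close> is the set of points of \<open>S\<close>
  around which arbitrarily small closed balls \<open>B\<close> of radius \<open>r\<close> carry more than \<open>s (2 r)\<^sup>k\<close> of \<open>S\<close>,
  with \<open>s > 1\<close>, then a Vitali family of such balls inside an open set approximating \<open>A\<close> shows that
  the measure of \<open>A\<close> is at most \<open>1/s\<close> times itself.

  For the lower bound, let \<open>\<gamma>\<close> be one of the curves and \<open>L t\<close> the limit of its Hoelder quotient at \<open>t\<close>.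
  The image of \<open>{L = 0}\<close> is a null set. The set \<open>{L > 0}\<close> is a countable union of sets on which the
  quotient lies, at a uniform scale, between \<open>l\<close> and \<open>\<theta> l\<close>, where \<open>\<theta> > 1\<close> is as close to \<open>1\<close> as we like.
  If \<open>A\<close> is the part of such a set that \<open>\<gamma>\<close> maps into \<open>S\<close> and \<open>t\<close> is a point of outer density of \<open>A\<close>,
  then \<open>B(\<gamma> t, r)\<close> contains the image of \<open>A\<close> intersected with an interval around \<open>t\<close> of length
  almost \<open>2 (r/l)\<^sup>k\<close>, and on \<open>A\<close> the map \<open>\<gamma>\<close> multiplies the one-dimensional measure by almost \<open>l\<^sup>k\<close>.\<close>

section \<open>Hausdorff outer measure\<close>

lemma ennreal_less_add:
  assumes "x < \<infinity>" "0 < e"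
  shows "x < x + ennreal e"
  using assms ennreal_add_left_cancel_less[of x 0 "ennreal e"] by simp

lemma ennreal_divide_le_iff:
  assumes "0 < c"
  shows "x / ennreal c \<le> y \<longleftrightarrow> x \<le> ennreal c * y"
proof
  assume "x / ennreal c \<le> y"
  then have "x / ennreal c * ennreal c \<le> y * ennreal c"
    by (rule mult_right_mono) simp
  then show "x \<le> ennreal c * y"
    using assms by (simp add: ennreal_divide_times mult.commute[of y])
next
  assume "x \<le> ennreal c * y"
  then have "x / ennreal c \<le> ennreal c * y / ennreal c"
    by (rule divide_right_mono_ennreal)
  then show "x / ennreal c \<le> y"
    using assms by (simp add: ennreal_mult_divide_eq mult.commute)
qed

lemma diameter_leI:
  fixes X :: "'a::metric_space set"
  assumes "0 \<le> d" and "\<And>x y. x \<in> X \<Longrightarrow> y \<in> X \<Longrightarrow> dist x y \<le> d"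
  shows "diameter X \<le> d"
  using assms by (auto simp: diameter_def intro: cSUP_least)

lemma hausdorff_premeasure_le_suminf:
  fixes A :: "'a::metric_space set"
  assumes "A \<subseteq> (\<Union>i. C i)" "\<And>i. bounded (C i)" "\<And>i. diameter (C i) \<le> \<epsilon>"
  shows "hausdorff_premeasure k \<epsilon> A \<le> (\<Sum>i. ennreal (diameter (C i) powr k))"
proof -
  have "(\<Union>i. C i) \<subseteq> (\<Union>i. closure (C i))"
    by (intro UN_mono closure_subset subset_refl)
  with assms(1) have "A \<subseteq> (\<Union>i. closure (C i))" by (rule subset_trans)
  moreover have "diameter (closure (C i)) = diameter (C i)" for i
    using assms(2) by (rule diameter_closure)
  moreover have "bounded (closure (C i))" for i
    using assms(2) by (rule bounded_closure)
  ultimately show ?thesis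
    unfolding hausdorff_premeasure_def using assms(3)
    by (intro Inf_lower CollectI exI[of _ "\<lambda>i. closure (C i)"]) simp
qed

lemma hausdorff_premeasure_le_suminf_bound:
  fixes A :: "'a::metric_space set"
  assumes "0 \<le> k" "A \<subseteq> (\<Union>i. C i)" "\<And>i. 0 \<le> d i" "\<And>i. d i \<le> \<epsilon>"
    and C: "\<And>i x y. x \<in> C i \<Longrightarrow> y \<in> C i \<Longrightarrow> dist x y \<le> d i"
  shows "hausdorff_premeasure k \<epsilon> A \<le> (\<Sum>i. ennreal (d i powr k))"
proof -
  have bd: "bounded (C i)" for i
    using C unfolding bounded_two_points by blast
  have di: "diameter (C i) \<le> d i" for i
    using assms by (intro diameter_leI) auto
  have "hausdorff_premeasure k \<epsilon> A \<le> (\<Sum>i. ennreal (diameter (C i) powr k))"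
    using assms(2) bd order_trans[OF di assms(4)] by (rule hausdorff_premeasure_le_suminf)
  also have "\<dots> \<le> (\<Sum>i. ennreal (d i powr k))"
    using assms di bd by (intro suminf_le ennreal_leI powr_mono2) (auto simp: diameter_ge_0)
  finally show ?thesis .
qed

lemma hausdorff_premeasure_lessE:
  fixes A :: "'a::metric_space set"
  assumes "hausdorff_premeasure k \<epsilon> A < c"
  obtains C where "A \<subseteq> (\<Union>i. C i)" "\<And>i. closed (C i)" "\<And>i. bounded (C i)"
    "\<And>i. diameter (C i) \<le> \<epsilon>" "(\<Sum>i. ennreal (diameter (C i) powr k)) < c"
  using assms unfolding hausdorff_premeasure_def Inf_less_iff by blast

lemma hausdorff_premeasure_mono:
  fixes A :: "'a::metric_space set"
  assumes "A \<subseteq> B"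
  shows "hausdorff_premeasure k \<epsilon> A \<le> hausdorff_premeasure k \<epsilon> B"
  unfolding hausdorff_premeasure_def using assms by (intro Inf_superset_mono) blast

lemma hausdorff_premeasure_empty:
  assumes "0 \<le> \<epsilon>"
  shows "hausdorff_premeasure k \<epsilon> ({} :: 'a::metric_space set) = 0"
  using hausdorff_premeasure_le_suminf[of "{}" "\<lambda>_. {} :: 'a set" \<epsilon> k] assms by simp

lemma hausdorff_premeasure_UN:
  fixes A :: "nat \<Rightarrow> 'a::metric_space set"
  shows "hausdorff_premeasure k \<epsilon> (\<Union>n. A n) \<le> (\<Sum>n. hausdorff_premeasure k \<epsilon> (A n))"
    (is "?l \<le> ?r")
proof (cases "?r = \<infinity>")
  case False
  show ?thesis
  proof (rule ennreal_le_epsilon)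
    fix e :: real assume e: "0 < e"
    have fin: "hausdorff_premeasure k \<epsilon> (A n) < \<infinity>" for n
      using False ennreal_suminf_lessD[of "\<lambda>n. hausdorff_premeasure k \<epsilon> (A n)" \<infinity> n]
      by (simp add: less_top)
    have "\<exists>C. A n \<subseteq> (\<Union>i. C i) \<and> (\<forall>i. closed (C i) \<and> bounded (C i) \<and> diameter (C i) \<le> \<epsilon>) \<and>
        (\<Sum>i. ennreal (diameter (C i) powr k)) < hausdorff_premeasure k \<epsilon> (A n) + ennreal (e * (1/2)^Suc n)"
      for n
    proof -
      have "hausdorff_premeasure k \<epsilon> (A n) < hausdorff_premeasure k \<epsilon> (A n) + ennreal (e * (1/2)^Suc n)"
        using fin[of n] e by (intro ennreal_less_add) auto
      then show ?thesis
        by (rule hausdorff_premeasure_lessE) blast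
    qed
    then have "\<forall>n. \<exists>C. A n \<subseteq> (\<Union>i. C i) \<and> (\<forall>i. closed (C i) \<and> bounded (C i) \<and> diameter (C i) \<le> \<epsilon>) \<and>
        (\<Sum>i. ennreal (diameter (C i) powr k)) < hausdorff_premeasure k \<epsilon> (A n) + ennreal (e * (1/2)^Suc n)"
      by (rule allI)
    from choice[OF this] obtain C where C: "\<And>n. A n \<subseteq> (\<Union>i. C n i)"
      "\<And>n i. bounded (C n i)" "\<And>n i. diameter (C n i) \<le> \<epsilon>"
      "\<And>n. (\<Sum>i. ennreal (diameter (C n i) powr k))
        < hausdorff_premeasure k \<epsilon> (A n) + ennreal (e * (1/2)^Suc n)"
      by blast
    define D where "D = (\<lambda>p. C (fst p) (snd p))"
    have "(\<Union>n. A n) \<subseteq> (\<Union>i. D (prod_decode i))"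
    proof
      fix x assume "x \<in> (\<Union>n. A n)"
      then obtain n i where "x \<in> C n i" using C(1) by blast
      then have "x \<in> D (prod_decode (prod_encode (n, i)))" by (simp add: D_def)
      then show "x \<in> (\<Union>i. D (prod_decode i))" by blast
    qed
    then have "?l \<le> (\<Sum>i. ennreal (diameter (D (prod_decode i)) powr k))"
      using C by (intro hausdorff_premeasure_le_suminf) (auto simp: D_def)
    also have "\<dots> = (\<Sum>n. \<Sum>i. ennreal (diameter (C n i) powr k))"
      by (rule suminf_ennreal_2dimen[where f="\<lambda>p. ennreal (diameter (D p) powr k)"]) (simp add: D_def)
    also have "\<dots> \<le> (\<Sum>n. hausdorff_premeasure k \<epsilon> (A n) + ennreal (e * (1/2)^Suc n))"
      using C(4) by (intro suminf_le) (auto intro: less_imp_le)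
    also have "\<dots> = ?r + (\<Sum>n. ennreal (e * (1/2)^Suc n))"
      by (rule suminf_add[symmetric]) auto
    also have "(\<Sum>n. ennreal (e * (1/2)^Suc n)) = ennreal e"
      using e sums_mult[OF power_half_series, of e] by (intro suminf_ennreal_eq) auto
    finally show "?l \<le> ?r + ennreal e" .
  qed
qed simp

lemma hausdorff_premeasure_Un:
  fixes A B :: "'a::metric_space set"
  assumes "0 \<le> \<epsilon>"
  shows "hausdorff_premeasure k \<epsilon> (A \<union> B) \<le> hausdorff_premeasure k \<epsilon> A + hausdorff_premeasure k \<epsilon> B"
proof -
  have "hausdorff_premeasure k \<epsilon> (A \<union> B) \<le> (\<Sum>n. hausdorff_premeasure k \<epsilon> (binaryset A B n))"
    using hausdorff_premeasure_UN[of k \<epsilon> "binaryset A B"] by (simp add: UN_binaryset_eq)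
  then show ?thesis
    using suminf_binaryset_eq[of "hausdorff_premeasure k \<epsilon>" A B] assms
    by (simp add: hausdorff_premeasure_empty)
qed

lemma hausdorff_premeasure_le_measure:
  assumes "0 < \<epsilon>"
  shows "hausdorff_premeasure k \<epsilon> A \<le> hausdorff_measure k A"
  unfolding hausdorff_measure_eq_SUP using assms by (intro SUP_upper) simp

lemma hausdorff_measure_leI:
  assumes "\<And>\<epsilon>. 0 < \<epsilon> \<Longrightarrow> hausdorff_premeasure k \<epsilon> A \<le> c"
  shows "hausdorff_measure k A \<le> c"
  unfolding hausdorff_measure_eq_SUP using assms by (intro SUP_least) simp

lemma hausdorff_measure_mono:
  "A \<subseteq> B \<Longrightarrow> hausdorff_measure k A \<le> hausdorff_measure k B"
  by (meson hausdorff_measure_leI hausdorff_premeasure_le_measure hausdorff_premeasure_mono order_trans)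

lemma hausdorff_measure_empty [simp]: "hausdorff_measure k {} = 0"
  using hausdorff_measure_leI[of k "{}" 0] by (simp add: hausdorff_premeasure_empty)

lemma hausdorff_measure_UN:
  "hausdorff_measure k (\<Union>n::nat. A n) \<le> (\<Sum>n. hausdorff_measure k (A n))"
proof (rule hausdorff_measure_leI)
  fix \<epsilon> :: real assume "0 < \<epsilon>"
  have "hausdorff_premeasure k \<epsilon> (\<Union>n. A n) \<le> (\<Sum>n. hausdorff_premeasure k \<epsilon> (A n))"
    by (rule hausdorff_premeasure_UN)
  also have "\<dots> \<le> (\<Sum>n. hausdorff_measure k (A n))"
    using \<open>0 < \<epsilon>\<close> by (intro suminf_le hausdorff_premeasure_le_measure) auto
  finally show "hausdorff_premeasure k \<epsilon> (\<Union>n. A n) \<le> (\<Sum>n. hausdorff_measure k (A n))" .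
qed

lemma hausdorff_measure_Un:
  "hausdorff_measure k (A \<union> B) \<le> hausdorff_measure k A + hausdorff_measure k B"
proof -
  have "hausdorff_measure k (A \<union> B) = hausdorff_measure k (\<Union>n. binaryset A B n)"
    by (simp add: UN_binaryset_eq)
  also have "\<dots> \<le> (\<Sum>n. hausdorff_measure k (binaryset A B n))"
    by (rule hausdorff_measure_UN)
  also have "\<dots> = hausdorff_measure k A + hausdorff_measure k B"
    by (simp add: suminf_binaryset_eq)
  finally show ?thesis .
qed

lemma hausdorff_measure_null_UN:
  assumes "countable I" "\<And>i. i \<in> I \<Longrightarrow> hausdorff_measure k (A i) = 0"
  shows "hausdorff_measure k (\<Union>i\<in>I. A i) = 0"
proof (cases "I = {}")
  case False
  have "hausdorff_measure k (\<Union>i\<in>I. A i) = hausdorff_measure k (\<Union>n. A (from_nat_into I n))"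
    using range_from_nat_into[OF False assms(1)] by (metis image_image)
  also have "\<dots> \<le> (\<Sum>n. hausdorff_measure k (A (from_nat_into I n)))"
    by (rule hausdorff_measure_UN)
  also have "\<dots> = 0"
    using assms(2) from_nat_into[OF False] by simp
  finally show ?thesis by simp
qed simp

lemma hausdorff_measure_null_subset:
  "hausdorff_measure k B = 0 \<Longrightarrow> A \<subseteq> B \<Longrightarrow> hausdorff_measure k A = 0"
  using hausdorff_measure_mono[of A B k] by simp

lemma hausdorff_measure_holder_image:
  fixes f :: "'a::metric_space \<Rightarrow> 'b::metric_space"
  assumes pos: "0 < C" "0 < \<alpha>" "0 \<le> k" "0 < \<delta>"
    and f: "\<And>x y. x \<in> A \<Longrightarrow> y \<in> A \<Longrightarrow> dist x y < \<delta> \<Longrightarrow> dist (f x) (f y) \<le> C * dist x y powr \<alpha>"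
  shows "hausdorff_measure k (f ` A) \<le> ennreal (C powr k) * hausdorff_measure (\<alpha> * k) A"
proof (rule hausdorff_measure_leI)
  fix \<epsilon> :: real assume \<epsilon>: "0 < \<epsilon>"
  define e where "e = min (\<delta> / 2) ((\<epsilon> / C) powr (1 / \<alpha>))"
  have e: "0 < e" "e < \<delta>" "C * e powr \<alpha> \<le> \<epsilon>"
  proof -
    have "0 < \<epsilon> / C" using pos \<epsilon> by simp
    then have "0 < (\<epsilon> / C) powr (1 / \<alpha>)" by (metis powr_gt_zero less_irrefl)
    then show "0 < e" unfolding e_def using pos(4) by linarith
    show "e < \<delta>" unfolding e_def using pos(4) by linarith
    have "e \<le> (\<epsilon> / C) powr (1 / \<alpha>)" unfolding e_def by simp
    then have "e powr \<alpha> \<le> ((\<epsilon> / C) powr (1 / \<alpha>)) powr \<alpha>"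
      using pos(2) \<open>0 < e\<close> by (intro powr_mono2) auto
    also have "\<dots> = \<epsilon> / C" using pos(1,2) \<epsilon> by (simp add: powr_powr)
    finally show "C * e powr \<alpha> \<le> \<epsilon>" using pos(1) by (simp add: pos_le_divide_eq mult.commute)
  qed
  have "hausdorff_premeasure k \<epsilon> (f ` A) \<le> ennreal (C powr k) * b"
    if b: "hausdorff_premeasure (\<alpha> * k) e A < b" for b
  proof -
    obtain D where D: "A \<subseteq> (\<Union>i. D i)" "\<And>i. bounded (D i)" "\<And>i. diameter (D i) \<le> e"
      "(\<Sum>i. ennreal (diameter (D i) powr (\<alpha> * k))) < b"
      using hausdorff_premeasure_lessE[OF b] by metis
    have "hausdorff_premeasure k \<epsilon> (f ` A) \<le> (\<Sum>i. ennreal ((C * diameter (D i) powr \<alpha>) powr k))"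
    proof (rule hausdorff_premeasure_le_suminf_bound)
      show "f ` A \<subseteq> (\<Union>i. f ` (A \<inter> D i))" using D(1) by blast
      fix i
      show "0 \<le> C * diameter (D i) powr \<alpha>" using pos by simp
      have "C * diameter (D i) powr \<alpha> \<le> C * e powr \<alpha>"
        using pos D by (intro mult_left_mono powr_mono2) (auto simp: diameter_ge_0)
      with e show "C * diameter (D i) powr \<alpha> \<le> \<epsilon>" by simp
      fix u v assume "u \<in> f ` (A \<inter> D i)" "v \<in> f ` (A \<inter> D i)"
      then obtain x y where xy: "x \<in> A" "x \<in> D i" "y \<in> A" "y \<in> D i" "u = f x" "v = f y" by auto
      have d: "dist x y \<le> diameter (D i)" using xy D by (intro diameter_bounded_bound) auto
      then have "dist (f x) (f y) \<le> C * dist x y powr \<alpha>"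
        using f xy D(3)[of i] e by (smt (verit))
      also have "\<dots> \<le> C * diameter (D i) powr \<alpha>"
        using pos d by (intro mult_left_mono powr_mono2) auto
      finally show "dist u v \<le> C * diameter (D i) powr \<alpha>" using xy by simp
    qed (use pos in auto)
    also have "\<dots> = (\<Sum>i. ennreal (C powr k) * ennreal (diameter (D i) powr (\<alpha> * k)))"
      using pos D(2) by (simp add: powr_mult powr_powr ennreal_mult diameter_ge_0)
    also have "\<dots> = ennreal (C powr k) * (\<Sum>i. ennreal (diameter (D i) powr (\<alpha> * k)))"
      by simp
    also have "\<dots> \<le> ennreal (C powr k) * b"
      using D(4) by (intro mult_left_mono) auto
    finally show ?thesis .
  qed
  then have "hausdorff_premeasure k \<epsilon> (f ` A) / ennreal (C powr k) \<le> b"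
    if "hausdorff_premeasure (\<alpha> * k) e A < b" for b
    using pos that by (subst ennreal_divide_le_iff) (auto simp: mult.commute)
  then have "hausdorff_premeasure k \<epsilon> (f ` A) / ennreal (C powr k) \<le> hausdorff_premeasure (\<alpha> * k) e A"
    by (rule dense_ge)
  then have "hausdorff_premeasure k \<epsilon> (f ` A) \<le> ennreal (C powr k) * hausdorff_premeasure (\<alpha> * k) e A"
    using pos by (subst (asm) ennreal_divide_le_iff) (auto simp: mult.commute)
  also have "\<dots> \<le> ennreal (C powr k) * hausdorff_measure (\<alpha> * k) A"
    using e by (intro mult_left_mono hausdorff_premeasure_le_measure) auto
  finally show "hausdorff_premeasure k \<epsilon> (f ` A) \<le> ennreal (C powr k) * hausdorff_measure (\<alpha> * k) A" .
qed

section \<open>Borel sets and outer regularity\<close>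

lemma hausdorff_measure_separated_Un:
  fixes X Y :: "'a::metric_space set"
  assumes "0 < \<rho>" and sep: "\<And>x y. x \<in> X \<Longrightarrow> y \<in> Y \<Longrightarrow> \<rho> \<le> dist x y"
  shows "hausdorff_measure k X + hausdorff_measure k Y \<le> hausdorff_measure k (X \<union> Y)"
proof -
  have split: "hausdorff_premeasure k \<epsilon> X + hausdorff_premeasure k \<epsilon> Y \<le> hausdorff_measure k (X \<union> Y)"
    if \<epsilon>: "0 < \<epsilon>" "\<epsilon> < \<rho>" for \<epsilon>
  proof -
    have "hausdorff_premeasure k \<epsilon> X + hausdorff_premeasure k \<epsilon> Y \<le> b"
      if b: "hausdorff_premeasure k \<epsilon> (X \<union> Y) < b" for b
    proof -
      obtain C where C: "X \<union> Y \<subseteq> (\<Union>i. C i)" "\<And>i. bounded (C i)" "\<And>i. diameter (C i) \<le> \<epsilon>"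
        "(\<Sum>i. ennreal (diameter (C i) powr k)) < b"
        using hausdorff_premeasure_lessE[OF b] by metis
      define CX where "CX i = (if C i \<inter> X = {} then {} else C i)" for i
      define CY where "CY i = (if C i \<inter> Y = {} then {} else C i)" for i
      have one: "C i \<inter> X = {} \<or> C i \<inter> Y = {}" for i
      proof (rule ccontr)
        assume "\<not> ?thesis"
        then obtain x y where "x \<in> C i" "x \<in> X" "y \<in> C i" "y \<in> Y" by blast
        then have "\<rho> \<le> dist x y" "dist x y \<le> diameter (C i)"
          using sep diameter_bounded_bound[OF C(2)] by auto
        with C(3)[of i] \<epsilon> show False by simp
      qed
      have "hausdorff_premeasure k \<epsilon> X \<le> (\<Sum>i. ennreal (diameter (CX i) powr k))"
      proof (rule hausdorff_premeasure_le_suminf)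
        show "X \<subseteq> (\<Union>i. CX i)"
        proof
          fix x assume "x \<in> X"
          moreover from this obtain i where "x \<in> C i" using C(1) by blast
          ultimately have "x \<in> CX i" by (auto simp: CX_def)
          then show "x \<in> (\<Union>i. CX i)" by blast
        qed
      qed (use C(2,3) \<epsilon>(1) in \<open>simp_all add: CX_def\<close>)
      moreover have "hausdorff_premeasure k \<epsilon> Y \<le> (\<Sum>i. ennreal (diameter (CY i) powr k))"
      proof (rule hausdorff_premeasure_le_suminf)
        show "Y \<subseteq> (\<Union>i. CY i)"
        proof
          fix x assume "x \<in> Y"
          moreover from this obtain i where "x \<in> C i" using C(1) by blast
          ultimately have "x \<in> CY i" by (auto simp: CY_def)
          then show "x \<in> (\<Union>i. CY i)" by blast
        qed
      qed (use C(2,3) \<epsilon>(1) in \<open>simp_all add: CY_def\<close>)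
      ultimately have "hausdorff_premeasure k \<epsilon> X + hausdorff_premeasure k \<epsilon> Y
          \<le> (\<Sum>i. ennreal (diameter (CX i) powr k)) + (\<Sum>i. ennreal (diameter (CY i) powr k))"
        by (rule add_mono)
      also have "\<dots> = (\<Sum>i. ennreal (diameter (CX i) powr k) + ennreal (diameter (CY i) powr k))"
        by (rule suminf_add) auto
      also have "\<dots> \<le> (\<Sum>i. ennreal (diameter (C i) powr k))"
        using one by (intro suminf_le) (auto simp: CX_def CY_def)
      finally show ?thesis using C(4) by simp
    qed
    then have "hausdorff_premeasure k \<epsilon> X + hausdorff_premeasure k \<epsilon> Y
        \<le> hausdorff_premeasure k \<epsilon> (X \<union> Y)"
      by (rule dense_ge)
    also have "\<dots> \<le> hausdorff_measure k (X \<union> Y)"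
      using \<epsilon> by (intro hausdorff_premeasure_le_measure)
    finally show ?thesis .
  qed
  have "((\<lambda>\<epsilon>. hausdorff_premeasure k \<epsilon> X + hausdorff_premeasure k \<epsilon> Y)
      \<longlongrightarrow> hausdorff_measure k X + hausdorff_measure k Y) (at_right 0)"
    unfolding hausdorff_measure_eq_SUP by (intro tendsto_add hausdorff_measure_tendsto_SUP)
  moreover have "\<forall>\<^sub>F \<epsilon> in at_right 0.
      hausdorff_premeasure k \<epsilon> X + hausdorff_premeasure k \<epsilon> Y \<le> hausdorff_measure k (X \<union> Y)"
    using split \<open>0 < \<rho>\<close> unfolding eventually_at_right_field by blast
  ultimately show ?thesis
    by (rule tendsto_upperbound) simp
qed

text \<open>Caratheodory's criterion. The layers \<open>R n\<close> of points of \<open>T\<close> at distance between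
  \<open>1/(n+2)\<close> and \<open>1/(n+1)\<close> from \<open>F\<close> have finite total measure, since nonadjacent layers are at
  positive distance; hence the measure of the part of \<open>T - F\<close> close to \<open>F\<close> tends to zero.\<close>

lemma hausdorff_measure_closed_additive:
  fixes F T :: "'a::metric_space set"
  assumes "closed F"
  shows "hausdorff_measure k (T \<inter> F) + hausdorff_measure k (T - F) = hausdorff_measure k T"
proof (rule antisym)
  have "hausdorff_measure k T = hausdorff_measure k ((T \<inter> F) \<union> (T - F))"
    by (simp add: Int_Diff_Un)
  then show "hausdorff_measure k T \<le> hausdorff_measure k (T \<inter> F) + hausdorff_measure k (T - F)"
    using hausdorff_measure_Un by metis
next
  let ?H = "hausdorff_measure k :: 'a set \<Rightarrow> ennreal"
  show "?H (T \<inter> F) + ?H (T - F) \<le> ?H T"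
  proof (cases "F = {} \<or> ?H T = \<infinity>")
    case True
    then show ?thesis by auto
  next
    case False
    then have F: "F \<noteq> {}" and fin: "?H T < \<infinity>" by (auto simp: less_top)
    define far where "far n = {x \<in> T. 1 / real (n + 1) \<le> infdist x F}" for n
    define R where "R n = far (n + 1) - far n" for n
    have "(\<Sum>i<n. ?H (R (2 * i + p))) \<le> ?H (\<Union>i<n. R (2 * i + p))" for n p
    proof (induction n)
      case (Suc n)
      show ?case
      proof (cases "n = 0")
        case False
        define \<rho> where "\<rho> = 1 / real (2 * n + p) - 1 / real (2 * n + p + 1)"
        have "0 < \<rho>" using False unfolding \<rho>_def diff_gt_0_iff_gt by (intro divide_strict_left_mono mult_pos_pos) auto
        have "\<rho> \<le> dist x y" if x: "x \<in> (\<Union>i<n. R (2 * i + p))" and y: "y \<in> R (2 * n + p)" for x y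
        proof -
          obtain i where i: "i < n" "x \<in> R (2 * i + p)" using x by blast
          then have "1 / real (2 * n + p) \<le> 1 / real (2 * i + p + 2)"
            by (intro divide_left_mono) auto
          also have "\<dots> \<le> infdist x F" using i by (simp add: R_def far_def)
          finally have "1 / real (2 * n + p) \<le> infdist x F" .
          moreover have "infdist y F < 1 / real (2 * n + p + 1)"
            using y by (auto simp: R_def far_def)
          ultimately show ?thesis
            using infdist_triangle_abs[of x F y] by (simp add: \<rho>_def)
        qed
        then have "?H (\<Union>i<n. R (2 * i + p)) + ?H (R (2 * n + p))
            \<le> ?H ((\<Union>i<n. R (2 * i + p)) \<union> R (2 * n + p))"
          using \<open>0 < \<rho>\<close> by (intro hausdorff_measure_separated_Un)
        also have "(\<Union>i<n. R (2 * i + p)) \<union> R (2 * n + p) = (\<Union>i<Suc n. R (2 * i + p))"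
          by (auto simp: lessThan_Suc)
        finally show ?thesis
          using order_trans[OF add_right_mono[OF Suc.IH]] by simp
      qed (simp add: lessThan_Suc)
    qed simp
    then have half: "(\<Sum>i<n. ?H (R (2 * i + p))) \<le> ?H T" for n p
      by (rule order_trans) (auto intro!: hausdorff_measure_mono simp: R_def far_def)
    have even_odd: "(\<Sum>i<2 * n. ?H (R i)) = (\<Sum>i<n. ?H (R (2 * i + 0))) + (\<Sum>i<n. ?H (R (2 * i + 1)))" for n
      by (induction n) (simp_all add: ac_simps)
    have "(\<Sum>i. ?H (R i)) \<le> ?H T + ?H T"
    proof (rule suminf_le_const)
      fix n
      have "(\<Sum>i<n. ?H (R i)) \<le> (\<Sum>i<2 * n. ?H (R i))"
        by (rule sum_mono2) auto
      also have "\<dots> \<le> ?H T + ?H T"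
        unfolding even_odd by (intro add_mono half)
      finally show "(\<Sum>i<n. ?H (R i)) \<le> ?H T + ?H T" .
    qed simp
    also have "\<dots> < \<infinity>" using fin by simp
    finally have sumR: "(\<Sum>i. ?H (R i)) < \<infinity>" .
    have bound: "?H (T \<inter> F) + ?H (T - F) + (\<Sum>i<m. ?H (R i)) \<le> ?H T + (\<Sum>i. ?H (R i))" for m
    proof -
      have "T - F \<subseteq> far m \<union> (\<Union>i. R (i + m))"
      proof
        fix x assume x: "x \<in> T - F"
        then have "0 < infdist x F" using assms F infdist_pos_not_in_closed by auto
        then obtain n where "inverse (real (Suc n)) < infdist x F"
          using reals_Archimedean by blast
        then have n: "x \<in> far n" using x by (simp add: far_def inverse_eq_divide add.commute)
        show "x \<in> far m \<union> (\<Union>i. R (i + m))"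
        proof (cases "x \<in> far m")
          case False
          define j where "j = (LEAST j. x \<in> far j)"
          have j: "x \<in> far j" unfolding j_def using n by (rule LeastI)
          have "m < j"
          proof (rule ccontr)
            assume "\<not> m < j"
            then have "1 / real (m + 1) \<le> 1 / real (j + 1)" by (intro divide_left_mono) auto
            with j False show False by (auto simp: far_def)
          qed
          then obtain i where i: "j = Suc (i + m)" by (metis add.commute less_imp_Suc_add)
          then have "x \<notin> far (i + m)" using not_less_Least[of "i + m" "\<lambda>j. x \<in> far j"] by (simp add: j_def)
          then have "x \<in> R (i + m)" using j i by (simp add: R_def)
          then show ?thesis by blast
        qed simp
      qed
      then have "?H (T - F) \<le> ?H (far m \<union> (\<Union>i. R (i + m)))"
        by (rule hausdorff_measure_mono)
      also have "\<dots> \<le> ?H (far m) + (\<Sum>i. ?H (R (i + m)))"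
        by (intro order_trans[OF hausdorff_measure_Un] add_left_mono hausdorff_measure_UN)
      finally have 1: "?H (T - F) \<le> ?H (far m) + (\<Sum>i. ?H (R (i + m)))" .
      have "?H (T \<inter> F) + ?H (far m) \<le> ?H ((T \<inter> F) \<union> far m)"
      proof (rule hausdorff_measure_separated_Un[where \<rho> = "1 / real (m + 1)"])
        fix x y assume "x \<in> T \<inter> F" "y \<in> far m"
        then show "1 / real (m + 1) \<le> dist x y"
          using infdist_le[of x F y] by (auto simp: far_def dist_commute)
      qed simp
      also have "\<dots> \<le> ?H T"
        by (rule hausdorff_measure_mono) (auto simp: far_def)
      finally have 2: "?H (T \<inter> F) + ?H (far m) \<le> ?H T" .
      have 3: "(\<Sum>i. ?H (R i)) = (\<Sum>i. ?H (R (i + m))) + (\<Sum>i<m. ?H (R i))"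
        by (rule suminf_offset) simp
      have "?H (T \<inter> F) + ?H (T - F) + (\<Sum>i<m. ?H (R i))
          \<le> ?H (T \<inter> F) + (?H (far m) + (\<Sum>i. ?H (R (i + m)))) + (\<Sum>i<m. ?H (R i))"
        by (intro add_mono 1 order_refl)
      also have "\<dots> = (?H (T \<inter> F) + ?H (far m)) + (\<Sum>i. ?H (R i))"
        unfolding 3 by (simp add: ac_simps)
      also have "\<dots> \<le> ?H T + (\<Sum>i. ?H (R i))"
        by (intro add_mono 2 order_refl)
      finally show ?thesis .
    qed
    have "(\<lambda>m. ?H (T \<inter> F) + ?H (T - F) + (\<Sum>i<m. ?H (R i)))
        \<longlonglongrightarrow> ?H (T \<inter> F) + ?H (T - F) + (\<Sum>i. ?H (R i))"
      by (intro tendsto_add tendsto_const summable_LIMSEQ) simp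
    then have "?H (T \<inter> F) + ?H (T - F) + (\<Sum>i. ?H (R i)) \<le> ?H T + (\<Sum>i. ?H (R i))"
      by (rule LIMSEQ_le_const2) (use bound in blast)
    then show ?thesis
      using sumR ennreal_add_left_cancel_le[of "\<Sum>i. ?H (R i)"] by (auto simp: add.commute)
  qed
qed

definition hausdorff_on :: "real \<Rightarrow> 'a::metric_space set \<Rightarrow> 'a measure" where
  "hausdorff_on k S = measure_of UNIV (sets borel) (\<lambda>E. hausdorff_measure k (S \<inter> E))"

lemma space_hausdorff_on [simp]: "space (hausdorff_on k S) = UNIV"
  by (simp add: hausdorff_on_def space_measure_of_conv)

lemma sets_hausdorff_on [simp, measurable_cong]: "sets (hausdorff_on k S) = sets borel"
  using sets.sigma_sets_eq[of borel] by (simp add: hausdorff_on_def sets_measure_of_conv)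

lemma emeasure_hausdorff_on:
  fixes S :: "'a::metric_space set"
  assumes E: "E \<in> sets borel"
  shows "emeasure (hausdorff_on k S) E = hausdorff_measure k (S \<inter> E)"
proof -
  let ?f = "\<lambda>E. hausdorff_measure k (S \<inter> E)"
  let ?L = "lambda_system UNIV UNIV ?f"
  have UN: "?f (\<Union>i. A i) \<le> (\<Sum>i. ?f (A i))" for A :: "nat \<Rightarrow> 'a set"
    using hausdorff_measure_UN[of k "\<lambda>i. S \<inter> A i"] by simp
  have "outer_measure_space UNIV ?f"
    unfolding outer_measure_space_def positive_def increasing_def countably_subadditive_def
    using UN by (auto intro!: hausdorff_measure_mono)
  then have L: "measure_space UNIV ?L ?f"
    using sigma_algebra.caratheodory_lemma[OF sigma_algebra_Pow, of "UNIV::'a set" ?f] by simp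
  have "F \<in> ?L" if "closed F" for F
  proof -
    have "?f (F \<inter> x) + ?f ((UNIV - F) \<inter> x) = ?f x" for x
    proof -
      have "S \<inter> (F \<inter> x) = (S \<inter> x) \<inter> F" "S \<inter> ((UNIV - F) \<inter> x) = (S \<inter> x) - F" by auto
      then show ?thesis using hausdorff_measure_closed_additive[OF that, of k "S \<inter> x"] by simp
    qed
    then show ?thesis by (simp add: lambda_system_def)
  qed
  then have "sigma_sets UNIV (Collect closed) \<subseteq> ?L"
    using L by (intro sigma_algebra.sigma_sets_subset) (auto simp: measure_space_def)
  then have "sets (borel :: 'a measure) \<subseteq> ?L"
    by (simp add: borel_eq_closed)
  moreover have "sigma_algebra UNIV (sets (borel :: 'a measure))"
    using sets.sigma_algebra_axioms[of "borel :: 'a measure"] by simp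
  ultimately have "measure_space UNIV (sets (borel :: 'a measure)) ?f"
    by (intro measure_down[OF L])
  then show ?thesis
    unfolding hausdorff_on_def measure_space_def using E
    by (elim conjE) (rule emeasure_measure_of_sigma)
qed

lemma hausdorff_measure_outer_regular:
  fixes A S :: "'a::metric_space set"
  assumes "0 < k" "A \<subseteq> S" and fin: "hausdorff_measure k S < \<infinity>" and "0 < \<delta>"
  obtains U where "open U" "A \<subseteq> U" "hausdorff_measure k (S \<inter> U) \<le> hausdorff_measure k A + ennreal \<delta>"
proof -
  let ?H = "hausdorff_measure k :: 'a set \<Rightarrow> ennreal"
  have finA: "?H A < \<infinity>" using hausdorff_measure_mono[OF \<open>A \<subseteq> S\<close>] fin by (rule le_less_trans)
  have ex: "\<exists>U. open U \<and> A \<subseteq> U \<and> hausdorff_premeasure k (2 * e) U \<le> ?H A + ennreal (2 * e)"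
    if e: "0 < e" for e
  proof -
    have "hausdorff_premeasure k e A < ?H A + ennreal e"
      using hausdorff_premeasure_le_measure[OF e] ennreal_less_add[OF finA e] by (rule le_less_trans)
    then obtain C where C: "A \<subseteq> (\<Union>i. C i)" "\<And>i. bounded (C i)" "\<And>i. diameter (C i) \<le> e"
        "(\<Sum>i. ennreal (diameter (C i) powr k)) < ?H A + ennreal e"
      using hausdorff_premeasure_lessE by metis
    have "\<exists>d>0. 2 * d \<le> e \<and> (diameter (C i) + 2 * d) powr k \<le> diameter (C i) powr k + e * (1/2)^Suc i" for i
    proof -
      have "((\<lambda>d. (diameter (C i) + 2 * d) powr k) \<longlongrightarrow> (diameter (C i) + 2 * 0) powr k) (at_right 0)"
        using \<open>0 < k\<close> C(2)[of i] by (intro tendsto_powr' tendsto_intros)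
          (auto simp: eventually_at_right_less eventually_at_filter diameter_ge_0 intro!: always_eventually)
      then have "\<forall>\<^sub>F d in at_right 0. (diameter (C i) + 2 * d) powr k < diameter (C i) powr k + e * (1/2)^Suc i"
        using e by (intro order_tendstoD) auto
      moreover have "\<forall>\<^sub>F d in at_right 0. d < e / 2"
        using e by (intro eventually_at_right_less order_tendstoD tendsto_intros) auto
      moreover have "\<forall>\<^sub>F d in at_right (0::real). 0 < d"
        by (rule eventually_at_right_less)
      ultimately have "\<forall>\<^sub>F d in at_right 0. 0 < d \<and> 2 * d \<le> e \<and>
          (diameter (C i) + 2 * d) powr k \<le> diameter (C i) powr k + e * (1/2)^Suc i"
        by eventually_elim auto
      then show ?thesis
        using eventually_happens'[of "at_right (0::real)"] by fastforce
    qed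
    then obtain d where d: "\<And>i. 0 < d i" "\<And>i. 2 * d i \<le> e"
      "\<And>i. (diameter (C i) + 2 * d i) powr k \<le> diameter (C i) powr k + e * (1/2)^Suc i"
      by metis
    define V where "V i = (\<Union>x\<in>C i. ball x (d i))" for i
    have CV: "C i \<subseteq> V i" for i using d(1) by (force simp: V_def)
    have "hausdorff_premeasure k (2 * e) (\<Union>i. V i) \<le> (\<Sum>i. ennreal ((diameter (C i) + 2 * d i) powr k))"
    proof (rule hausdorff_premeasure_le_suminf_bound)
      fix i
      show "0 \<le> diameter (C i) + 2 * d i" using d(1)[of i] C(2) by (simp add: diameter_ge_0)
      show "diameter (C i) + 2 * d i \<le> 2 * e" using d(2)[of i] C(3)[of i] by simp
      fix x y assume "x \<in> V i" "y \<in> V i"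
      then obtain u v where uv: "u \<in> C i" "v \<in> C i" "dist u x < d i" "dist v y < d i"
        by (auto simp: V_def)
      have "dist x y \<le> dist u x + dist u v + dist v y"
        by metric
      then show "dist x y \<le> diameter (C i) + 2 * d i"
        using diameter_bounded_bound[OF C(2) uv(1,2)] uv by simp
    qed (use \<open>0 < k\<close> in auto)
    also have "\<dots> \<le> (\<Sum>i. ennreal (diameter (C i) powr k) + ennreal (e * (1/2)^Suc i))"
      using d(3) e by (intro suminf_le) (auto simp flip: ennreal_plus intro!: ennreal_leI)
    also have "\<dots> = (\<Sum>i. ennreal (diameter (C i) powr k)) + (\<Sum>i. ennreal (e * (1/2)^Suc i))"
      by (rule suminf_add[symmetric]) auto
    also have "(\<Sum>n. ennreal (e * (1/2)^Suc n)) = ennreal e"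
      using e sums_mult[OF power_half_series, of e] by (intro suminf_ennreal_eq) auto
    also have "(\<Sum>i. ennreal (diameter (C i) powr k)) + ennreal e \<le> (?H A + ennreal e) + ennreal e"
      using C(4) by (intro add_right_mono) simp
    also have "\<dots> = ?H A + ennreal (2 * e)"
      using e by (simp add: add.assoc flip: ennreal_plus)
    finally have "hausdorff_premeasure k (2 * e) (\<Union>i. V i) \<le> ?H A + ennreal (2 * e)" .
    moreover have "open (\<Union>i. V i)" by (auto simp: V_def)
    moreover have "A \<subseteq> (\<Union>i. V i)" using C(1) CV by blast
    ultimately show ?thesis by blast
  qed
  have "\<exists>U. open U \<and> A \<subseteq> U \<and>
      hausdorff_premeasure k (2 * (1 / real (Suc n))) U \<le> ?H A + ennreal (2 * (1 / real (Suc n)))" for n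
    by (rule ex) simp
  then obtain U where U: "\<And>n. open (U n)" "\<And>n. A \<subseteq> U n"
    "\<And>n. hausdorff_premeasure k (2 * (1 / real (Suc n))) (U n) \<le> ?H A + ennreal (2 * (1 / real (Suc n)))"
    by metis
  define G where "G n = (\<Inter>m\<le>n. U m)" for n
  have G: "open (G n)" "A \<subseteq> G n" for n
    using U by (auto simp: G_def intro!: open_INT)
  have lim0: "(\<lambda>n. 2 * (1 / real (Suc n))) \<longlonglongrightarrow> 0"
    using tendsto_mult_right_zero[OF LIMSEQ_inverse_real_of_nat, of 2] by (simp add: inverse_eq_divide)
  have "?H (\<Inter>n. U n) \<le> ?H A"
  proof (rule hausdorff_measure_leI)
    fix \<epsilon> :: real assume "0 < \<epsilon>"
    have "(\<lambda>n. ?H A + ennreal (2 * (1 / real (Suc n)))) \<longlonglongrightarrow> ?H A + ennreal 0"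
      by (intro tendsto_intros lim0)
    moreover have "\<forall>\<^sub>F n in sequentially. hausdorff_premeasure k \<epsilon> (\<Inter>n. U n) \<le> ?H A + ennreal (2 * (1 / real (Suc n)))"
      using order_tendstoD(2)[OF lim0 \<open>0 < \<epsilon>\<close>]
    proof eventually_elim
      case (elim n)
      have "hausdorff_premeasure k \<epsilon> (\<Inter>n. U n) \<le> hausdorff_premeasure k (2 * (1 / real (Suc n))) (\<Inter>n. U n)"
        using elim by (intro hausdorff_premeasure_antimono) simp
      also have "\<dots> \<le> hausdorff_premeasure k (2 * (1 / real (Suc n))) (U n)"
        by (rule hausdorff_premeasure_mono) auto
      finally show ?case using U(3) by (rule order_trans)
    qed
    ultimately show "hausdorff_premeasure k \<epsilon> (\<Inter>n. U n) \<le> ?H A"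
      using tendsto_lowerbound[of _ "?H A + ennreal 0" sequentially] by simp
  qed
  then have HG: "?H (S \<inter> (\<Inter>n. G n)) \<le> ?H A"
    using hausdorff_measure_mono[of "S \<inter> (\<Inter>n. G n)" "\<Inter>n. U n" k]
    by (auto simp: G_def intro: order_trans)
  have "(\<lambda>n. emeasure (hausdorff_on k S) (G n)) \<longlonglongrightarrow> emeasure (hausdorff_on k S) (\<Inter>n. G n)"
  proof (rule Lim_emeasure_decseq)
    show "range G \<subseteq> sets (hausdorff_on k S)" using G by auto
    show "decseq G" by (auto simp: decseq_def G_def)
    fix n
    have "?H (S \<inter> G n) \<le> ?H S" by (rule hausdorff_measure_mono) auto
    with fin have "?H (S \<inter> G n) \<noteq> \<infinity>" by (simp add: less_top top_unique)
    then show "emeasure (hausdorff_on k S) (G n) \<noteq> \<infinity>" using G by (simp add: emeasure_hausdorff_on)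
  qed
  moreover have "(\<Inter>n. G n) \<in> sets borel" using G by auto
  ultimately have "(\<lambda>n. ?H (S \<inter> G n)) \<longlonglongrightarrow> ?H (S \<inter> (\<Inter>n. G n))"
    using G by (simp add: emeasure_hausdorff_on)
  moreover have "?H (S \<inter> (\<Inter>n. G n)) < ?H A + ennreal \<delta>"
    using HG ennreal_less_add[OF finA \<open>0 < \<delta>\<close>] by (rule le_less_trans)
  ultimately have "\<forall>\<^sub>F n in sequentially. ?H (S \<inter> G n) < ?H A + ennreal \<delta>"
    by (rule order_tendstoD)
  then obtain n where "?H (S \<inter> G n) < ?H A + ennreal \<delta>"
    using eventually_happens'[of sequentially] by auto
  then show thesis using that[of "G n"] G by simp
qed

lemma hausdorff_measure_disjoint_closed_sum:
  fixes S :: "'a::metric_space set"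
  assumes "finite I" "disjoint_family_on B I" "\<And>i. i \<in> I \<Longrightarrow> closed (B i)"
  shows "(\<Sum>i\<in>I. hausdorff_measure k (S \<inter> B i)) = hausdorff_measure k (S \<inter> (\<Union>i\<in>I. B i))"
proof -
  have "(\<Sum>i\<in>I. hausdorff_measure k (S \<inter> B i)) = (\<Sum>i\<in>I. emeasure (hausdorff_on k S) (B i))"
    using assms by (intro sum.cong) (auto simp: emeasure_hausdorff_on)
  also have "\<dots> = emeasure (hausdorff_on k S) (\<Union>i\<in>I. B i)"
    using assms by (intro sum_emeasure) auto
  also have "\<dots> = hausdorff_measure k (S \<inter> (\<Union>i\<in>I. B i))"
    using assms by (intro emeasure_hausdorff_on borel_closed closed_UN) auto
  finally show ?thesis .
qed

lemma hausdorff_measure_disjoint_borel_suminf: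
  fixes S :: "'a::metric_space set"
  assumes "disjoint_family B" "\<And>i. B i \<in> sets borel"
  shows "(\<Sum>i. hausdorff_measure k (S \<inter> B i)) = hausdorff_measure k (S \<inter> (\<Union>i. B i))"
proof -
  have "(\<Sum>i. hausdorff_measure k (S \<inter> B i)) = (\<Sum>i. emeasure (hausdorff_on k S) (B i))"
    using assms by (simp add: emeasure_hausdorff_on)
  also have "\<dots> = emeasure (hausdorff_on k S) (\<Union>i. B i)"
    using assms by (intro suminf_emeasure) auto
  also have "\<dots> = hausdorff_measure k (S \<inter> (\<Union>i. B i))"
    using assms by (intro emeasure_hausdorff_on sets.countable_UN) auto
  finally show ?thesis .
qed

section \<open>Vitali coverings and the upper density\<close>

lemma vitali_disjoint_subfamily:
  fixes K :: "('a::metric_space \<times> real) set"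
  defines "b \<equiv> \<lambda>p. cball (fst p) (snd p)"
  assumes K: "\<And>x r. (x, r) \<in> K \<Longrightarrow> 0 < r \<and> r \<le> R"
  shows "\<exists>D\<subseteq>K. disjoint_family_on b D \<and>
    (\<forall>p\<in>K. \<exists>q\<in>D. b p \<inter> b q \<noteq> {} \<and> snd p \<le> 2 * snd q)"
proof -
  define \<A> where "\<A> = {D. D \<subseteq> K \<and> disjoint_family_on b D \<and>
    (\<forall>p\<in>K. (\<exists>q\<in>D. b p \<inter> b q \<noteq> {}) \<longrightarrow> (\<exists>q\<in>D. b p \<inter> b q \<noteq> {} \<and> snd p \<le> 2 * snd q))}"
  have "\<exists>M\<in>\<A>. \<forall>X\<in>\<A>. M \<subseteq> X \<longrightarrow> X = M"
  proof (rule subset_Zorn_nonempty)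
    have "{} \<in> \<A>" by (simp add: \<A>_def disjoint_family_on_def)
    then show "\<A> \<noteq> {}" by blast
    fix \<C> assume "subset.chain \<A> \<C>"
    then have sub: "\<And>X. X \<in> \<C> \<Longrightarrow> X \<in> \<A>"
      and chain: "\<And>X Y. X \<in> \<C> \<Longrightarrow> Y \<in> \<C> \<Longrightarrow> X \<subseteq> Y \<or> Y \<subseteq> X"
      by (auto simp: subset_chain_def)
    have "b p \<inter> b q = {}" if pq: "p \<in> X" "X \<in> \<C>" "q \<in> Y" "Y \<in> \<C>" "p \<noteq> q" for p q X Y
    proof -
      obtain Z where "Z \<in> \<C>" "p \<in> Z" "q \<in> Z" using chain[OF pq(2,4)] pq by blast
      with sub[of Z] \<open>p \<noteq> q\<close> show ?thesis by (auto simp: \<A>_def disjoint_family_on_def)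
    qed
    then have "disjoint_family_on b (\<Union>\<C>)"
      by (auto simp: disjoint_family_on_def)
    moreover have "\<Union>\<C> \<subseteq> K" using sub unfolding \<A>_def by blast
    moreover have "\<exists>q\<in>\<Union>\<C>. b p \<inter> b q \<noteq> {} \<and> snd p \<le> 2 * snd q"
      if p: "p \<in> K" and q: "q \<in> \<Union>\<C>" "b p \<inter> b q \<noteq> {}" for p q
    proof -
      obtain X where X: "X \<in> \<C>" "q \<in> X" using q by blast
      then have "\<exists>q\<in>X. b p \<inter> b q \<noteq> {} \<and> snd p \<le> 2 * snd q"
        using sub[OF X(1)] p q(2) unfolding \<A>_def by blast
      then show ?thesis using X by blast
    qed
    ultimately show "\<Union>\<C> \<in> \<A>" unfolding \<A>_def by blast
  qed
  then obtain M where M: "M \<in> \<A>" and max: "\<And>X. X \<in> \<A> \<Longrightarrow> M \<subseteq> X \<Longrightarrow> X = M" by blast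
  have M1: "M \<subseteq> K" "disjoint_family_on b M"
    and M2: "\<And>p q. p \<in> K \<Longrightarrow> q \<in> M \<Longrightarrow> b p \<inter> b q \<noteq> {} \<Longrightarrow> \<exists>q\<in>M. b p \<inter> b q \<noteq> {} \<and> snd p \<le> 2 * snd q"
    using M unfolding \<A>_def by blast+
  define N where "N = {p \<in> K. \<forall>q\<in>M. b p \<inter> b q = {}}"
  have "N = {}"
  proof (rule ccontr)
    assume ne: "N \<noteq> {}"
    have bdd: "bdd_above (snd ` N)"
      using K by (intro bdd_aboveI[of _ R]) (auto simp: N_def)
    define s where "s = Sup (snd ` N)"
    have s: "snd p \<le> s" if "p \<in> N" for p
      unfolding s_def using bdd that by (intro cSup_upper) auto
    from ne obtain p where "p \<in> N" by blast
    then have "0 < s" using s[of p] K[of "fst p" "snd p"] by (auto simp: N_def)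
    then have "s / 2 < s" by simp
    then obtain p0 where p0: "p0 \<in> N" "s / 2 < snd p0"
      using less_cSupD[of "snd ` N" "s / 2"] ne unfolding s_def by auto
    have "disjoint_family_on b (insert p0 M)"
      using M1(2) p0(1) by (auto simp: disjoint_family_on_def N_def)
    moreover have "insert p0 M \<subseteq> K" using M1 p0 by (auto simp: N_def)
    moreover have "\<exists>q\<in>insert p0 M. b p \<inter> b q \<noteq> {} \<and> snd p \<le> 2 * snd q"
      if p: "p \<in> K" and q: "q \<in> insert p0 M" "b p \<inter> b q \<noteq> {}" for p q
    proof (cases "p \<in> N")
      case True
      then have "q = p0" using q by (auto simp: N_def)
      moreover have "snd p \<le> 2 * snd p0" using s[OF True] p0 by simp
      ultimately show ?thesis using q by blast
    next
      case False
      then show ?thesis using p M2 unfolding N_def by blast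
    qed
    ultimately have "insert p0 M \<in> \<A>" unfolding \<A>_def by blast
    then have "p0 \<in> M" using max by blast
    then have "b p0 = {}" using p0 by (auto simp: N_def)
    moreover have "fst p0 \<in> b p0" using p0 K[of "fst p0" "snd p0"] by (auto simp: b_def N_def)
    ultimately show False by simp
  qed
  have "\<exists>q\<in>M. b p \<inter> b q \<noteq> {} \<and> snd p \<le> 2 * snd q" if "p \<in> K" for p
  proof -
    have "p \<notin> N" using \<open>N = {}\<close> by simp
    then have "\<exists>q\<in>M. b p \<inter> b q \<noteq> {}" using \<open>p \<in> K\<close> by (simp add: N_def)
    then show ?thesis using M2[OF \<open>p \<in> K\<close>] by blast
  qed
  then show ?thesis using M1 by (intro exI[of _ M]) simp
qed

lemma vitali_covering_hausdorff:
  fixes A :: "'a::metric_space set" and K :: "('a \<times> real) set"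
  assumes k: "0 < k"
    and K: "\<And>x r. (x, r) \<in> K \<Longrightarrow> 0 < r \<and> r \<le> R"
    and fine: "\<And>x d. x \<in> A \<Longrightarrow> 0 < d \<Longrightarrow> \<exists>r<d. (x, r) \<in> K"
    and bound: "\<And>F. finite F \<Longrightarrow> F \<subseteq> K \<Longrightarrow> disjoint_family_on (\<lambda>p. cball (fst p) (snd p)) F
      \<Longrightarrow> (\<Sum>p\<in>F. (2 * snd p) powr k) \<le> c"
  shows "\<exists>(B :: nat \<Rightarrow> 'a set) \<rho>. disjoint_family B \<and>
    (\<forall>n. B n = {} \<and> \<rho> n = 0 \<or> (\<exists>x. (x, \<rho> n) \<in> K \<and> B n = cball x (\<rho> n))) \<and>
    hausdorff_measure k (A - (\<Union>n. B n)) = 0"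
proof -
  define b :: "'a \<times> real \<Rightarrow> 'a set" where "b = (\<lambda>p. cball (fst p) (snd p))"
  have "\<exists>D\<subseteq>K. disjoint_family_on b D \<and>
      (\<forall>p\<in>K. \<exists>q\<in>D. b p \<inter> b q \<noteq> {} \<and> snd p \<le> 2 * snd q)"
    unfolding b_def by (rule vitali_disjoint_subfamily) (erule K)
  then obtain D where D: "D \<subseteq> K" "disjoint_family_on b D"
    and cov: "\<And>p. p \<in> K \<Longrightarrow> \<exists>q\<in>D. b p \<inter> b q \<noteq> {} \<and> snd p \<le> 2 * snd q"
    by blast
  have bound': "(\<Sum>p\<in>F. (2 * snd p) powr k) \<le> c" if "finite F" "F \<subseteq> D" for F
    using that D disjoint_family_on_mono[OF that(2) D(2)] by (intro bound) (auto simp: b_def)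
  have "(\<lambda>p. (2 * snd p) powr k) summable_on D"
    using bound' by (intro nonneg_bdd_above_summable_on bdd_aboveI[of _ c]) auto
  then have "countable {p \<in> D. (2 * snd p) powr k \<noteq> 0}"
    by (rule summable_countable_real)
  moreover have "{p \<in> D. (2 * snd p) powr k \<noteq> 0} = D"
    using D(1) K by force
  ultimately have cD: "countable D" by simp
  define I where "I = to_nat_on D ` D"
  define g where "g = from_nat_into D"
  have g: "g n \<in> D" if "n \<in> I" for n
    using that cD by (auto simp: g_def I_def)
  have inj: "inj_on g I"
    using cD by (auto simp: g_def I_def inj_on_def)
  have to_g: "\<exists>n\<in>I. g n = p" if "p \<in> D" for p
    using that cD by (auto simp: g_def I_def)
  define B where "B n = (if n \<in> I then b (g n) else {})" for n
  define \<rho> where "\<rho> n = (if n \<in> I then snd (g n) else 0)" for n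
  have \<rho>0: "0 \<le> \<rho> n" for n
    using g[of n] D(1) K[of "fst (g n)" "snd (g n)"] by (auto simp: \<rho>_def)
  have disj: "disjoint_family B"
  proof (unfold disjoint_family_on_def, intro ballI impI)
    fix m n :: nat assume "m \<noteq> n"
    show "B m \<inter> B n = {}"
    proof (cases "m \<in> I \<and> n \<in> I")
      case True
      then have "g m \<noteq> g n" using inj \<open>m \<noteq> n\<close> by (auto dest: inj_onD)
      then show ?thesis using True D(2) g by (simp add: disjoint_family_on_def B_def)
    qed (auto simp: B_def)
  qed
  have ball: "B n = {} \<and> \<rho> n = 0 \<or> (\<exists>x. (x, \<rho> n) \<in> K \<and> B n = cball x (\<rho> n))" for n
    using g[of n] D(1) by (auto simp: B_def \<rho>_def b_def intro!: exI[of _ "fst (g n)"])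
  have summ: "summable (\<lambda>n. (2 * \<rho> n) powr k)"
  proof (rule summableI_nonneg_bounded)
    fix n
    have "(\<Sum>i<n. (2 * \<rho> i) powr k) = (\<Sum>i\<in>I \<inter> {..<n}. (2 * snd (g i)) powr k)"
      by (rule sum.mono_neutral_cong_right) (auto simp: \<rho>_def)
    also have "\<dots> = (\<Sum>p\<in>g ` (I \<inter> {..<n}). (2 * snd p) powr k)"
      using inj by (subst sum.reindex) (auto intro: inj_on_subset)
    also have "\<dots> \<le> c" using g by (intro bound') auto
    finally show "(\<Sum>i<n. (2 * \<rho> i) powr k) \<le> c" .
  qed simp
  have "hausdorff_measure k (A - (\<Union>n. B n)) \<le> 0"
  proof (rule hausdorff_measure_leI, rule ennreal_le_epsilon)
    fix \<epsilon> \<eta> :: real assume "0 < \<epsilon>" "0 < \<eta>"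
    define h where "h = min (\<eta> / 3 powr k) ((\<epsilon> / 3) powr k)"
    have "0 < h" using \<open>0 < \<epsilon>\<close> \<open>0 < \<eta>\<close> by (simp add: h_def)
    then obtain N where "norm (\<Sum>i. (2 * \<rho> (i + N)) powr k) < h"
      using suminf_exist_split[OF _ summ] by blast
    then have N: "(\<Sum>i. (2 * \<rho> (i + N)) powr k) < h" by simp
    have summN: "summable (\<lambda>i. (2 * \<rho> (i + N)) powr k)"
      using summ by (rule summable_ignore_initial_segment)
    define C where "C i = (if i + N \<in> I then cball (fst (g (i + N))) (3 * \<rho> (i + N)) else {})" for i
    have "hausdorff_premeasure k \<epsilon> (A - (\<Union>n. B n)) \<le> (\<Sum>i. ennreal ((3 * (2 * \<rho> (i + N))) powr k))"
    proof (rule hausdorff_premeasure_le_suminf_bound)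
      show "A - (\<Union>n. B n) \<subseteq> (\<Union>i. C i)"
      proof
        fix x assume x: "x \<in> A - (\<Union>n. B n)"
        have "closed (\<Union>n<N. B n)" by (intro closed_UN) (auto simp: B_def b_def)
        moreover have "x \<in> - (\<Union>n<N. B n)" using x by blast
        ultimately obtain d where d: "0 < d" "ball x d \<subseteq> - (\<Union>n<N. B n)"
          using openE[of "- (\<Union>n<N. B n)" x] open_Compl by blast
        obtain r where r: "r < d" "(x, r) \<in> K" using fine[of x d] x d by blast
        obtain q where q: "q \<in> D" "b (x, r) \<inter> b q \<noteq> {}" "r \<le> 2 * snd q"
          using cov[OF r(2)] by auto
        obtain n where n: "n \<in> I" "g n = q" using to_g[OF q(1)] by blast
        obtain y where y: "dist x y \<le> r" "dist (fst q) y \<le> snd q" "y \<in> B n"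
          using q(2) n by (auto simp: b_def B_def)
        have "y \<in> ball x d" using y r by simp
        then have "\<not> n < N" using d(2) y(3) by blast
        then obtain i where i: "n = i + N" by (metis add.commute le_iff_add not_less)
        have "dist (fst q) x \<le> dist (fst q) y + dist x y" by metric
        then have "dist (fst q) x \<le> 3 * \<rho> n" using y q(3) n by (simp add: \<rho>_def)
        then have "x \<in> C i" using n i by (simp add: C_def)
        then show "x \<in> (\<Union>i. C i)" by blast
      qed
      fix i
      show "0 \<le> 3 * (2 * \<rho> (i + N))" using \<rho>0 by simp
      have "(2 * \<rho> (i + N)) powr k \<le> (\<Sum>i. (2 * \<rho> (i + N)) powr k)"
        using sum_le_suminf[OF summN, of "{i}"] by simp
      also have "\<dots> < (\<epsilon> / 3) powr k" using N by (simp add: h_def)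
      finally have "\<not> (\<epsilon> / 3) powr k \<le> (2 * \<rho> (i + N)) powr k" by simp
      then have "\<not> \<epsilon> / 3 \<le> 2 * \<rho> (i + N)"
        using powr_mono2[of k "\<epsilon> / 3" "2 * \<rho> (i + N)"] k \<open>0 < \<epsilon>\<close> by linarith
      then show "3 * (2 * \<rho> (i + N)) \<le> \<epsilon>" by simp
      fix x y assume "x \<in> C i" "y \<in> C i"
      then have "dist (fst (g (i + N))) x \<le> 3 * \<rho> (i + N)" "dist (fst (g (i + N))) y \<le> 3 * \<rho> (i + N)"
        by (auto simp: C_def split: if_splits)
      moreover have "dist x y \<le> dist (fst (g (i + N))) x + dist (fst (g (i + N))) y" by metric
      ultimately show "dist x y \<le> 3 * (2 * \<rho> (i + N))" by simp
    qed (use k in auto)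
    also have "\<dots> = (\<Sum>i. ennreal (3 powr k * (2 * \<rho> (i + N)) powr k))"
      by (simp only: powr_mult[of 3])
    also have "\<dots> = ennreal (\<Sum>i. 3 powr k * (2 * \<rho> (i + N)) powr k)"
      by (rule suminf_ennreal2, simp, rule summable_mult[OF summN])
    also have "(\<Sum>i. 3 powr k * (2 * \<rho> (i + N)) powr k) = 3 powr k * (\<Sum>i. (2 * \<rho> (i + N)) powr k)"
      using summN by (rule suminf_mult)
    also have "ennreal \<dots> \<le> ennreal \<eta>"
    proof (rule ennreal_leI)
      have "(\<Sum>i. (2 * \<rho> (i + N)) powr k) \<le> \<eta> / 3 powr k" using N by (simp add: h_def)
      then show "3 powr k * (\<Sum>i. (2 * \<rho> (i + N)) powr k) \<le> \<eta>" by (simp add: pos_le_divide_eq mult.commute)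
    qed
    finally show "hausdorff_premeasure k \<epsilon> (A - (\<Union>n. B n)) \<le> 0 + ennreal \<eta>" by simp
  qed
  then show ?thesis using disj ball by (intro exI[of _ B] exI[of _ \<rho>]) simp
qed

lemma hausdorff_upper_density:
  fixes S :: "'a::metric_space set"
  assumes k: "0 < k" and fin: "hausdorff_measure k S < \<infinity>" and s: "1 < s"
  shows "hausdorff_measure k
    {q \<in> S. \<exists>\<^sub>F r in at_right 0. ennreal (s * (2 * r) powr k) < hausdorff_measure k (S \<inter> cball q r)} = 0"
    (is "hausdorff_measure k ?A = 0")
proof -
  let ?H = "hausdorff_measure k :: 'a set \<Rightarrow> ennreal"
  have finA: "?H ?A < \<infinity>" using hausdorff_measure_mono[of ?A S k] fin by (auto intro: le_less_trans)
  have bd: "?H ?A \<le> ennreal (1 / s) * (?H ?A + ennreal \<delta>)" if \<delta>: "0 < \<delta>" for \<delta>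
  proof (rule hausdorff_measure_leI)
    fix \<epsilon> :: real assume \<epsilon>: "0 < \<epsilon>"
    obtain U where U: "open U" "?A \<subseteq> U" "?H (S \<inter> U) \<le> ?H ?A + ennreal \<delta>"
      using hausdorff_measure_outer_regular[OF k _ fin \<delta>, of ?A] by blast
    define K where "K = {(x, r). 0 < r \<and> 2 * r \<le> \<epsilon> \<and> cball x r \<subseteq> U \<and>
        ennreal (s * (2 * r) powr k) < ?H (S \<inter> cball x r)}"
    have K: "0 < r \<and> r \<le> \<epsilon> / 2" if "(x, r) \<in> K" for x r
      using that by (simp add: K_def)
    have fine: "\<exists>r<d. (x, r) \<in> K" if x: "x \<in> ?A" and d: "0 < d" for x d
    proof -
      obtain e where e: "0 < e" "cball x e \<subseteq> U"
        using U x open_contains_cball by blast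
      have "\<forall>\<^sub>F r in at_right 0. r < d \<and> r < e \<and> r < \<epsilon> / 2"
        using d e \<epsilon> by (intro eventually_conj order_tendstoD tendsto_ident_at) auto
      moreover have "\<forall>\<^sub>F r in at_right (0::real). 0 < r" by (rule eventually_at_right_less)
      moreover have "\<exists>\<^sub>F r in at_right 0. ennreal (s * (2 * r) powr k) < ?H (S \<inter> cball x r)"
        using x by simp
      ultimately obtain r where "r < d \<and> r < e \<and> r < \<epsilon> / 2" "0 < r"
        "ennreal (s * (2 * r) powr k) < ?H (S \<inter> cball x r)"
        using frequently_ex[OF frequently_eventually_frequently[OF _ eventually_conj]] by blast
      moreover from this have "cball x r \<subseteq> U" using e by (meson less_imp_le subset_cball subset_trans)
      ultimately show ?thesis by (auto simp: K_def)
    qed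
    have bound: "(\<Sum>p\<in>F. (2 * snd p) powr k) \<le> enn2real (?H S) / s"
      if F: "finite F" "F \<subseteq> K" "disjoint_family_on (\<lambda>p. cball (fst p) (snd p)) F" for F
    proof -
      have "ennreal (s * (\<Sum>p\<in>F. (2 * snd p) powr k)) = (\<Sum>p\<in>F. ennreal (s * (2 * snd p) powr k))"
        using s by (simp add: sum_distrib_left)
      also have "\<dots> \<le> (\<Sum>p\<in>F. ?H (S \<inter> cball (fst p) (snd p)))"
        using F(2) by (intro sum_mono) (auto simp: K_def intro: less_imp_le)
      also have "\<dots> = ?H (S \<inter> (\<Union>p\<in>F. cball (fst p) (snd p)))"
        using F by (intro hausdorff_measure_disjoint_closed_sum) auto
      also have "\<dots> \<le> ?H S" by (rule hausdorff_measure_mono) auto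
      also have "\<dots> = ennreal (enn2real (?H S))" using fin by simp
      finally have "s * (\<Sum>p\<in>F. (2 * snd p) powr k) \<le> enn2real (?H S)"
        by simp
      then show ?thesis using s by (simp add: pos_le_divide_eq mult.commute)
    qed
    have "\<exists>(B :: nat \<Rightarrow> 'a set) \<rho>. disjoint_family B \<and>
        (\<forall>n. B n = {} \<and> \<rho> n = 0 \<or> (\<exists>x. (x, \<rho> n) \<in> K \<and> B n = cball x (\<rho> n))) \<and>
        ?H (?A - (\<Union>n. B n)) = 0"
      by (rule vitali_covering_hausdorff) (fact k, erule K, erule (1) fine, erule (2) bound)
    then obtain B :: "nat \<Rightarrow> 'a set" and \<rho> where B: "disjoint_family B"
      "\<And>n. B n = {} \<and> \<rho> n = 0 \<or> (\<exists>x. (x, \<rho> n) \<in> K \<and> B n = cball x (\<rho> n))"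
      "?H (?A - (\<Union>n. B n)) = 0"
      by blast
    have \<rho>: "0 \<le> \<rho> n" "2 * \<rho> n \<le> \<epsilon>" for n
      using B(2)[of n] \<epsilon> by (auto simp: K_def)
    have Bn: "ennreal ((2 * \<rho> n) powr k) \<le> ennreal (1 / s) * ?H (S \<inter> B n)" for n
    proof (cases "B n = {} \<and> \<rho> n = 0")
      case False
      then have "ennreal (s * (2 * \<rho> n) powr k) \<le> ?H (S \<inter> B n)"
        using B(2)[of n] by (auto simp: K_def less_imp_le)
      then have "ennreal (1 / s) * ennreal (s * (2 * \<rho> n) powr k) \<le> ennreal (1 / s) * ?H (S \<inter> B n)"
        by (rule mult_left_mono) simp
      then show ?thesis using s by (simp flip: ennreal_mult)
    qed (use k in simp)
    have "hausdorff_premeasure k \<epsilon> (\<Union>n. B n) \<le> (\<Sum>n. ennreal ((2 * \<rho> n) powr k))"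
    proof (rule hausdorff_premeasure_le_suminf_bound)
      fix n x y assume "x \<in> B n" "y \<in> B n"
      then obtain z where "dist z x \<le> \<rho> n" "dist z y \<le> \<rho> n" using B(2)[of n] by auto
      moreover have "dist x y \<le> dist z x + dist z y" by metric
      ultimately show "dist x y \<le> 2 * \<rho> n" by simp
    qed (use k \<rho> in auto)
    also have "\<dots> \<le> (\<Sum>n. ennreal (1 / s) * ?H (S \<inter> B n))"
      using Bn by (intro suminf_le) auto
    also have "\<dots> = ennreal (1 / s) * (\<Sum>n. ?H (S \<inter> B n))" by simp
    also have "(\<Sum>n. ?H (S \<inter> B n)) = ?H (S \<inter> (\<Union>n. B n))"
    proof (rule hausdorff_measure_disjoint_borel_suminf[OF B(1)])
      show "B n \<in> sets borel" for n using B(2)[of n] by auto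
    qed
    also have "ennreal (1 / s) * \<dots> \<le> ennreal (1 / s) * ?H (S \<inter> U)"
    proof (intro mult_left_mono hausdorff_measure_mono Int_mono subset_refl UN_least)
      fix n show "B n \<subseteq> U" using B(2)[of n] unfolding K_def by blast
    qed simp
    also have "\<dots> \<le> ennreal (1 / s) * (?H ?A + ennreal \<delta>)"
      using U(3) by (intro mult_left_mono) auto
    finally have 1: "hausdorff_premeasure k \<epsilon> (\<Union>n. B n) \<le> ennreal (1 / s) * (?H ?A + ennreal \<delta>)" .
    have "hausdorff_premeasure k \<epsilon> ?A \<le> hausdorff_premeasure k \<epsilon> ((\<Union>n. B n) \<union> (?A - (\<Union>n. B n)))"
      unfolding Un_Diff_cancel by (intro hausdorff_premeasure_mono Un_upper2)
    also have "\<dots> \<le> hausdorff_premeasure k \<epsilon> (\<Union>n. B n) + hausdorff_premeasure k \<epsilon> (?A - (\<Union>n. B n))"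
      using \<epsilon> by (intro hausdorff_premeasure_Un) simp
    also have "hausdorff_premeasure k \<epsilon> (?A - (\<Union>n. B n)) = 0"
      using hausdorff_premeasure_le_measure[OF \<epsilon>, of k "?A - (\<Union>n. B n)"] B(3) by simp
    finally show "hausdorff_premeasure k \<epsilon> ?A \<le> ennreal (1 / s) * (?H ?A + ennreal \<delta>)"
      using 1 by (simp add: order_trans)
  qed
  obtain h where h: "0 \<le> h" "?H ?A = ennreal h"
    using finA by (cases "?H ?A") auto
  have "h \<le> (1 / s) * (h + \<delta>)" if "0 < \<delta>" for \<delta>
    using bd[OF that] h s that by (simp flip: ennreal_plus ennreal_mult)
  then have "s * h \<le> h + \<delta>" if "0 < \<delta>" for \<delta>
    using that s by (simp add: field_simps)
  then have "s * h \<le> h" by (rule field_le_epsilon)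
  then have "(s - 1) * h \<le> 0" by (simp add: algebra_simps)
  then have "h \<le> 0" using s by (simp add: mult_le_0_iff)
  then show ?thesis using h by simp
qed

section \<open>Lower density on the real line\<close>

lemma hausdorff_measure_1_interval_finite:
  "hausdorff_measure 1 {a..b::real} < \<infinity>"
proof -
  have "hausdorff_measure 1 {a..b} \<le> ennreal (\<bar>b - a\<bar> + 2)"
  proof (rule hausdorff_measure_leI)
    fix \<epsilon> :: real assume "0 < \<epsilon>"
    define h where "h = min \<epsilon> 1"
    have h: "0 < h" "h \<le> \<epsilon>" "h \<le> 1" using \<open>0 < \<epsilon>\<close> by (auto simp: h_def)
    define m where "m = Suc (nat \<lceil>\<bar>b - a\<bar> / h\<rceil>)"
    define C where "C i = (if i < m then {a + real i * h .. a + (real i + 1) * h} else {})" for i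
    define d where "d i = (if i < m then h else 0)" for i
    have cover: "{a..b} \<subseteq> (\<Union>i. C i)"
    proof
      fix x assume x: "x \<in> {a..b}"
      define i where "i = nat \<lfloor>(x - a) / h\<rfloor>"
      have "0 \<le> (x - a) / h" using x h by simp
      then have i: "real i \<le> (x - a) / h" "(x - a) / h < real i + 1"
        by (simp_all add: i_def)
      have "(x - a) / h \<le> \<bar>b - a\<bar> / h" using x h by (intro divide_right_mono) auto
      also have "\<dots> \<le> real (nat \<lceil>\<bar>b - a\<bar> / h\<rceil>)" by linarith
      finally have "(x - a) / h < real m" by (simp add: m_def)
      then have "i < m" using i by linarith
      moreover have "real i * h \<le> x - a" "x - a \<le> (real i + 1) * h"
        using i h by (simp_all add: field_simps)
      ultimately have "x \<in> C i" by (simp add: C_def)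
      then show "x \<in> (\<Union>i. C i)" by blast
    qed
    have "hausdorff_premeasure 1 \<epsilon> {a..b} \<le> (\<Sum>i. ennreal (d i powr 1))"
    proof (rule hausdorff_premeasure_le_suminf_bound[OF _ cover])
      fix i x y assume "x \<in> C i" "y \<in> C i"
      then show "dist x y \<le> d i"
        by (auto simp: C_def d_def dist_real_def algebra_simps split: if_splits)
    qed (use h in \<open>auto simp: d_def\<close>)
    also have "\<dots> = (\<Sum>i<m. ennreal (d i powr 1))"
      by (rule suminf_finite) (auto simp: d_def)
    also have "\<dots> = (\<Sum>i<m. ennreal h)"
      using h by (intro sum.cong) (auto simp: d_def)
    also have "\<dots> = ennreal (real m * h)"
      using h by (simp add: ennreal_of_nat_eq_real_of_nat ennreal_mult)
    also have "\<dots> \<le> ennreal (\<bar>b - a\<bar> + 2)"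
    proof (rule ennreal_leI)
      have "real m \<le> \<bar>b - a\<bar> / h + 2"
        unfolding m_def of_nat_Suc using divide_nonneg_pos[OF abs_ge_zero[of "b - a"] h(1)] by linarith
      then have "real m * h \<le> (\<bar>b - a\<bar> / h + 2) * h"
        using h(1) by (intro mult_right_mono) simp_all
      also have "\<dots> = \<bar>b - a\<bar> + 2 * h" using h by (simp add: field_simps)
      finally show "real m * h \<le> \<bar>b - a\<bar> + 2" using h by simp
    qed
    finally show "hausdorff_premeasure 1 \<epsilon> {a..b} \<le> ennreal (\<bar>b - a\<bar> + 2)" .
  qed
  then show ?thesis by (rule le_less_trans) simp
qed

lemma emeasure_lborel_le_diameter:
  fixes C :: "real set"
  assumes "closed C" "bounded C"
  shows "emeasure lborel C \<le> ennreal (diameter C)"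
proof (cases "C = {}")
  case False
  have bdd: "bdd_below C" "bdd_above C"
    using assms by (auto intro: bounded_imp_bdd_below bounded_imp_bdd_above)
  have mem: "Inf C \<in> C" "Sup C \<in> C"
    using closed_contains_Inf[OF False bdd(1) assms(1)] closed_contains_Sup[OF False bdd(2) assms(1)] by auto
  have "C \<subseteq> {Inf C..Sup C}"
    using bdd by (auto intro: cInf_lower cSup_upper)
  then have "emeasure lborel C \<le> emeasure lborel {Inf C..Sup C}"
    by (rule emeasure_mono) simp
  also have "\<dots> = ennreal (Sup C - Inf C)"
    using cSup_upper[OF mem(1) bdd(2)] by simp
  also have "\<dots> \<le> ennreal (diameter C)"
    using diameter_bounded_bound[OF assms(2) mem(2,1)] by (intro ennreal_leI) (simp add: dist_real_def)
  finally show ?thesis .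
qed simp

lemma hausdorff_measure_1_interval_ge:
  assumes "a \<le> b"
  shows "ennreal (b - a) \<le> hausdorff_measure 1 {a..b::real}"
proof -
  have "ennreal (b - a) \<le> hausdorff_premeasure 1 1 {a..b}"
  proof (rule dense_ge)
    fix c assume c: "hausdorff_premeasure 1 1 {a..b} < c"
    obtain C where C: "{a..b} \<subseteq> (\<Union>i. C i)" "\<And>i. closed (C i)" "\<And>i. bounded (C i)"
      "(\<Sum>i. ennreal (diameter (C i) powr 1)) < c"
      using hausdorff_premeasure_lessE[OF c] by metis
    have meas: "C i \<in> sets lborel" for i using C(2) by simp
    have "ennreal (b - a) = emeasure lborel {a..b}" using assms by simp
    also have "\<dots> \<le> emeasure lborel (\<Union>i. C i)"
      using meas by (intro emeasure_mono C(1) sets.countable_UN) auto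
    also have "\<dots> \<le> (\<Sum>i. emeasure lborel (C i))"
      using meas by (intro emeasure_subadditive_countably) auto
    also have "\<dots> \<le> (\<Sum>i. ennreal (diameter (C i) powr 1))"
      using emeasure_lborel_le_diameter[OF C(2,3)] diameter_ge_0[OF C(3)] by (intro suminf_le) simp_all
    finally show "ennreal (b - a) \<le> c" using C(4) by simp
  qed
  also have "\<dots> \<le> hausdorff_measure 1 {a..b}"
    by (rule hausdorff_premeasure_le_measure) simp
  finally show ?thesis .
qed

lemma hausdorff_1_lower_density:
  fixes A :: "real set"
  assumes A: "A \<subseteq> {a..b}" and s: "0 \<le> s" "s < 1"
  shows "hausdorff_measure 1
    {t \<in> A. \<exists>\<^sub>F r in at_right 0. hausdorff_measure 1 (A \<inter> cball t r) < ennreal (s * (2 * r))} = 0"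
    (is "hausdorff_measure 1 ?A = 0")
proof -
  let ?H = "hausdorff_measure 1 :: real set \<Rightarrow> ennreal"
  define S where "S = {a - 1..b + 1}"
  have fin: "?H S < \<infinity>" unfolding S_def by (rule hausdorff_measure_1_interval_finite)
  have AS: "?A \<subseteq> S" using A by (auto simp: S_def)
  have finA: "?H ?A < \<infinity>" using hausdorff_measure_mono[OF AS] fin by (rule le_less_trans)
  have bd: "?H ?A \<le> ennreal s * (?H ?A + ennreal \<delta>)" if \<delta>: "0 < \<delta>" for \<delta>
  proof -
    obtain U where U: "open U" "?A \<subseteq> U" "?H (S \<inter> U) \<le> ?H ?A + ennreal \<delta>"
      using hausdorff_measure_outer_regular[OF _ AS fin \<delta>] by auto
    define K where "K = {(x, r). 0 < r \<and> r \<le> 1 \<and> x \<in> {a..b} \<and> cball x r \<subseteq> U \<and>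
        ?H (A \<inter> cball x r) < ennreal (s * (2 * r))}"
    have K: "0 < r \<and> r \<le> 1" if "(x, r) \<in> K" for x r
      using that by (simp add: K_def)
    have ballS: "ennreal (2 * r) \<le> ?H (S \<inter> cball x r)" if "(x, r) \<in> K" for x r
    proof -
      have "S \<inter> cball x r = {x - r..x + r}"
        using that by (auto simp: K_def S_def cball_eq_atLeastAtMost)
      then show ?thesis
        using hausdorff_measure_1_interval_ge[of "x - r" "x + r"] K[OF that] by simp
    qed
    have fine: "\<exists>r<d. (x, r) \<in> K" if x: "x \<in> ?A" and d: "0 < d" for x d
    proof -
      obtain e where e: "0 < e" "cball x e \<subseteq> U"
        using U x open_contains_cball by blast
      have "\<forall>\<^sub>F r in at_right 0. r < d \<and> r < e \<and> r < 1"
        using d e by (intro eventually_conj order_tendstoD tendsto_ident_at) auto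
      moreover have "\<forall>\<^sub>F r in at_right (0::real). 0 < r" by (rule eventually_at_right_less)
      moreover have "\<exists>\<^sub>F r in at_right 0. ?H (A \<inter> cball x r) < ennreal (s * (2 * r))"
        using x by simp
      ultimately obtain r where "r < d \<and> r < e \<and> r < 1" "0 < r"
        "?H (A \<inter> cball x r) < ennreal (s * (2 * r))"
        using frequently_ex[OF frequently_eventually_frequently[OF _ eventually_conj]] by blast
      moreover from this have "cball x r \<subseteq> U" using e by (meson less_imp_le subset_cball subset_trans)
      moreover have "x \<in> {a..b}" using x A by blast
      ultimately show ?thesis by (auto simp: K_def)
    qed
    have bound: "(\<Sum>p\<in>F. (2 * snd p) powr 1) \<le> enn2real (?H S)"
      if F: "finite F" "F \<subseteq> K" "disjoint_family_on (\<lambda>p. cball (fst p) (snd p)) F" for F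
    proof -
      have pos: "0 < snd p" if "p \<in> F" for p
        using that F(2) K[of "fst p" "snd p"] by auto
      have "ennreal (\<Sum>p\<in>F. 2 * snd p) = (\<Sum>p\<in>F. ennreal (2 * snd p))"
        using pos by (subst sum_ennreal) (auto intro: less_imp_le)
      also have "\<dots> \<le> (\<Sum>p\<in>F. ?H (S \<inter> cball (fst p) (snd p)))"
        using F(2) by (intro sum_mono ballS) auto
      also have "\<dots> = ?H (S \<inter> (\<Union>p\<in>F. cball (fst p) (snd p)))"
        using F by (intro hausdorff_measure_disjoint_closed_sum) auto
      also have "\<dots> \<le> ?H S" by (rule hausdorff_measure_mono) auto
      also have "\<dots> = ennreal (enn2real (?H S))" using fin by simp
      finally have "(\<Sum>p\<in>F. 2 * snd p) \<le> enn2real (?H S)" by simp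
      moreover have "(\<Sum>p\<in>F. (2 * snd p) powr 1) = (\<Sum>p\<in>F. 2 * snd p)"
        using pos by (intro sum.cong) (simp_all add: less_imp_le)
      ultimately show ?thesis by simp
    qed
    have "\<exists>(B :: nat \<Rightarrow> real set) \<rho>. disjoint_family B \<and>
        (\<forall>n. B n = {} \<and> \<rho> n = 0 \<or> (\<exists>x. (x, \<rho> n) \<in> K \<and> B n = cball x (\<rho> n))) \<and>
        ?H (?A - (\<Union>n. B n)) = 0"
      by (rule vitali_covering_hausdorff) (simp, erule K, erule (1) fine, erule (2) bound)
    then obtain B :: "nat \<Rightarrow> real set" and \<rho> where B: "disjoint_family B"
      "\<And>n. B n = {} \<and> \<rho> n = 0 \<or> (\<exists>x. (x, \<rho> n) \<in> K \<and> B n = cball x (\<rho> n))"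
      "?H (?A - (\<Union>n. B n)) = 0"
      by blast
    have Bn: "?H (A \<inter> B n) \<le> ennreal s * ?H (S \<inter> B n)" for n
    proof (cases "B n = {} \<and> \<rho> n = 0")
      case False
      then obtain x where x: "(x, \<rho> n) \<in> K" "B n = cball x (\<rho> n)" using B(2)[of n] by blast
      then have "?H (A \<inter> B n) \<le> ennreal (s * (2 * \<rho> n))" by (simp add: K_def less_imp_le)
      also have "\<dots> = ennreal s * ennreal (2 * \<rho> n)" using s K[OF x(1)] by (intro ennreal_mult) auto
      also have "\<dots> \<le> ennreal s * ?H (S \<inter> B n)"
        unfolding x(2) by (intro mult_left_mono ballS x(1)) simp
      finally show ?thesis .
    qed simp
    have "?H ?A \<le> ?H ((\<Union>n. A \<inter> B n) \<union> (?A - (\<Union>n. B n)))"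
      by (rule hausdorff_measure_mono) blast
    also have "\<dots> \<le> ?H (\<Union>n. A \<inter> B n) + ?H (?A - (\<Union>n. B n))"
      by (rule hausdorff_measure_Un)
    also have "\<dots> = ?H (\<Union>n. A \<inter> B n)" using B(3) by simp
    also have "\<dots> \<le> (\<Sum>n. ?H (A \<inter> B n))" by (rule hausdorff_measure_UN)
    also have "\<dots> \<le> (\<Sum>n. ennreal s * ?H (S \<inter> B n))"
      using Bn by (intro suminf_le) auto
    also have "\<dots> = ennreal s * (\<Sum>n. ?H (S \<inter> B n))" by simp
    also have "(\<Sum>n. ?H (S \<inter> B n)) = ?H (S \<inter> (\<Union>n. B n))"
    proof (rule hausdorff_measure_disjoint_borel_suminf[OF B(1)])
      show "B n \<in> sets borel" for n using B(2)[of n] by auto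
    qed
    also have "ennreal s * \<dots> \<le> ennreal s * ?H (S \<inter> U)"
    proof (intro mult_left_mono hausdorff_measure_mono Int_mono subset_refl UN_least)
      fix n show "B n \<subseteq> U" using B(2)[of n] unfolding K_def by blast
    qed simp
    also have "\<dots> \<le> ennreal s * (?H ?A + ennreal \<delta>)"
      using U(3) by (intro mult_left_mono) auto
    finally show ?thesis .
  qed
  obtain h where h: "0 \<le> h" "?H ?A = ennreal h"
    using finA by (cases "?H ?A") auto
  have "h \<le> s * (h + \<delta>)" if "0 < \<delta>" for \<delta>
    using bd[OF that] h s that by (simp flip: ennreal_plus ennreal_mult)
  moreover have "s * (h + \<delta>) \<le> s * h + \<delta>" if "0 < \<delta>" for \<delta>
    using that s mult_right_mono[of s 1 \<delta>] by (simp add: distrib_left)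
  ultimately have "h \<le> s * h + \<delta>" if "0 < \<delta>" for \<delta>
    using that by (meson order_trans)
  then have "h \<le> s * h" by (rule field_le_epsilon)
  then have "(1 - s) * h \<le> 0" by (simp add: algebra_simps)
  then have "h \<le> 0" using s by (simp add: mult_le_0_iff)
  then show ?thesis using h by simp
qed

section \<open>Curves\<close>

lemma hausdorff_measure_holder_image_real:
  fixes \<gamma> :: "real \<Rightarrow> 'a::metric_space"
  assumes "0 < k" "0 < C" "0 < \<delta>"
    and "\<And>t u. t \<in> A \<Longrightarrow> u \<in> A \<Longrightarrow> \<bar>u - t\<bar> < \<delta> \<Longrightarrow> dist (\<gamma> u) (\<gamma> t) \<le> C * \<bar>u - t\<bar> powr (1 / k)"
  shows "hausdorff_measure k (\<gamma> ` A) \<le> ennreal (C powr k) * hausdorff_measure 1 A"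
  using hausdorff_measure_holder_image[of C "1 / k" k \<delta> A \<gamma>] assms by (simp add: dist_real_def)

lemma hausdorff_measure_flat_part:
  fixes \<gamma> :: "real \<Rightarrow> 'a::metric_space"
  assumes k: "0 < k" and cont: "continuous_on {a..b} \<gamma>"
    and Z: "Z \<subseteq> {a..b}" and flat: "\<And>t \<epsilon>. t \<in> Z \<Longrightarrow> 0 < \<epsilon> \<Longrightarrow>
      \<exists>n. \<forall>u\<in>{a..b}. \<bar>u - t\<bar> < 1 / real (Suc n) \<longrightarrow> dist (\<gamma> u) (\<gamma> t) \<le> \<epsilon> * \<bar>u - t\<bar> powr (1 / k)"
  shows "hausdorff_measure k (\<gamma> ` Z) = 0"
proof -
  obtain h where h: "0 \<le> h" "hausdorff_measure 1 {a..b} = ennreal h"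
    using hausdorff_measure_1_interval_finite[of a b] by (cases "hausdorff_measure 1 {a..b}") auto
  have bound: "hausdorff_measure k (\<gamma> ` Z) \<le> ennreal (\<epsilon> powr k * h)" if \<epsilon>: "0 < \<epsilon>" for \<epsilon>
  proof -
    define Q where "Q n u = {t \<in> {a..b}. \<bar>u - t\<bar> < 1 / real (Suc n) \<longrightarrow>
        dist (\<gamma> u) (\<gamma> t) \<le> \<epsilon> * \<bar>u - t\<bar> powr (1 / k)}" for n u
    define Y where "Y n = {a..b} \<inter> (\<Inter>u\<in>{a..b}. Q n u)" for n
    have "closed (Q n u)" for n u
    proof -
      have "Q n u = {t \<in> {a..b}. 1 / real (Suc n) \<le> \<bar>u - t\<bar>} \<union>
          {t \<in> {a..b}. dist (\<gamma> u) (\<gamma> t) \<le> \<epsilon> * \<bar>u - t\<bar> powr (1 / k)}"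
        by (auto simp: Q_def)
      moreover have "closed {t \<in> {a..b}. 1 / real (Suc n) \<le> \<bar>u - t\<bar>}"
        by (intro continuous_on_closed_Collect_le continuous_intros) auto
      moreover have "closed {t \<in> {a..b}. dist (\<gamma> u) (\<gamma> t) \<le> \<epsilon> * \<bar>u - t\<bar> powr (1 / k)}"
        using k by (intro continuous_on_closed_Collect_le continuous_intros continuous_on_powr' cont) auto
      ultimately show ?thesis by (simp only: closed_Un)
    qed
    then have Y: "closed (Y n)" for n unfolding Y_def by (intro closed_Int closed_INT) auto
    define W where "W = disjointed Y"
    have WY: "W n \<subseteq> Y n" for n by (simp add: W_def disjointed_subset)
    have W: "W n \<in> sets borel" for n
    proof -
      have "range Y \<subseteq> sets borel" using Y borel_closed by blast
      then show ?thesis using sets.range_disjointed_sets[of Y borel] unfolding W_def by blast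
    qed
    have Zsub: "Z \<subseteq> (\<Union>n. W n)"
    proof
      fix t assume t: "t \<in> Z"
      obtain n where "\<forall>u\<in>{a..b}. \<bar>u - t\<bar> < 1 / real (Suc n) \<longrightarrow> dist (\<gamma> u) (\<gamma> t) \<le> \<epsilon> * \<bar>u - t\<bar> powr (1 / k)"
        using flat[OF t \<epsilon>] by blast
      then have "t \<in> Y n" using t Z by (auto simp: Y_def Q_def)
      then show "t \<in> (\<Union>n. W n)" unfolding W_def UN_disjointed_eq by blast
    qed
    have Wab: "{a..b} \<inter> W n = W n" for n using WY by (auto simp: Y_def)
    have "hausdorff_measure k (\<gamma> ` Z) \<le> hausdorff_measure k (\<Union>n. \<gamma> ` W n)"
      using Zsub by (intro hausdorff_measure_mono) blast
    also have "\<dots> \<le> (\<Sum>n. hausdorff_measure k (\<gamma> ` W n))"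
      by (rule hausdorff_measure_UN)
    also have "\<dots> \<le> (\<Sum>n. ennreal (\<epsilon> powr k) * hausdorff_measure 1 (W n))"
    proof (rule suminf_le)
      fix n
      show "hausdorff_measure k (\<gamma> ` W n) \<le> ennreal (\<epsilon> powr k) * hausdorff_measure 1 (W n)"
      proof (rule hausdorff_measure_holder_image_real[OF k \<epsilon>])
        fix t u assume tu: "t \<in> W n" "u \<in> W n" "\<bar>u - t\<bar> < 1 / real (Suc n)"
        then have "u \<in> {a..b}" "t \<in> Q n u" using WY[of n] by (auto simp: Y_def)
        with tu(3) show "dist (\<gamma> u) (\<gamma> t) \<le> \<epsilon> * \<bar>u - t\<bar> powr (1 / k)" by (simp add: Q_def)
      qed simp
    qed auto
    also have "\<dots> = ennreal (\<epsilon> powr k) * (\<Sum>n. hausdorff_measure 1 ({a..b} \<inter> W n))"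
      by (simp add: Wab)
    also have "(\<Sum>n. hausdorff_measure 1 ({a..b} \<inter> W n)) = hausdorff_measure 1 ({a..b} \<inter> (\<Union>n. W n))"
      using W by (intro hausdorff_measure_disjoint_borel_suminf) (simp_all add: W_def disjoint_family_disjointed)
    also have "ennreal (\<epsilon> powr k) * \<dots> \<le> ennreal (\<epsilon> powr k) * hausdorff_measure 1 {a..b}"
      by (intro mult_left_mono hausdorff_measure_mono) auto
    also have "\<dots> = ennreal (\<epsilon> powr k * h)"
      using h by (simp add: ennreal_mult)
    finally show ?thesis .
  qed
  have "hausdorff_measure k (\<gamma> ` Z) \<le> 0"
  proof (rule ennreal_le_epsilon)
    fix \<eta> :: real assume \<eta>: "0 < \<eta>"
    define \<epsilon> where "\<epsilon> = (\<eta> / (h + 1)) powr (1 / k)"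
    have pos: "0 < \<eta> / (h + 1)" using \<eta> h by simp
    then have "0 < \<epsilon>" unfolding \<epsilon>_def powr_gt_zero by (rule less_imp_neq[symmetric])
    then have "hausdorff_measure k (\<gamma> ` Z) \<le> ennreal (\<epsilon> powr k * h)" by (rule bound)
    also have "\<epsilon> powr k = \<eta> / (h + 1)" using \<eta> h k by (simp add: \<epsilon>_def powr_powr)
    also have "ennreal (\<eta> / (h + 1) * h) \<le> ennreal \<eta>"
      using \<eta> h by (intro ennreal_leI) (simp add: field_simps)
    finally show "hausdorff_measure k (\<gamma> ` Z) \<le> 0 + ennreal \<eta>" by simp
  qed
  then show ?thesis by simp
qed

text \<open>On a set \<open>A\<close> of parameters where the \<open>1/k\<close>-Hoelder quotient of \<open>\<gamma>\<close> is uniformly close to a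
  constant \<open>l\<close>, small pieces of \<open>\<gamma>\<close> are almost isometric to the snowflake of the line scaled by \<open>l\<close>.\<close>

lemma lower_density_at_parameter:
  fixes \<gamma> :: "real \<Rightarrow> 'a::metric_space"
  assumes k: "0 < k" and l: "0 < l" and \<theta>: "1 < \<theta>" and \<delta>: "0 < \<delta>" and s: "0 \<le> s" and t: "t \<in> A"
    and AS: "\<gamma> ` A \<subseteq> S"
    and lower: "\<And>t u. t \<in> A \<Longrightarrow> u \<in> A \<Longrightarrow> \<bar>u - t\<bar> < \<delta> \<Longrightarrow> l * \<bar>u - t\<bar> powr (1 / k) \<le> dist (\<gamma> u) (\<gamma> t)"
    and upper: "\<And>t u. t \<in> A \<Longrightarrow> u \<in> A \<Longrightarrow> \<bar>u - t\<bar> < \<delta> \<Longrightarrow> dist (\<gamma> u) (\<gamma> t) \<le> \<theta> * l * \<bar>u - t\<bar> powr (1 / k)"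
    and dens: "\<forall>\<^sub>F r in at_right 0. ennreal (s * (2 * r)) \<le> hausdorff_measure 1 (A \<inter> cball t r)"
  shows "\<forall>\<^sub>F r in at_right 0. ennreal (2 * s * (1 / \<theta>\<^sup>2) powr k * r powr k) \<le> hausdorff_measure k (S \<inter> ball (\<gamma> t) r)"
proof -
  define c where "c = \<theta>\<^sup>2 * l"
  have c: "0 < c" using l \<theta> by (simp add: c_def)
  define \<rho> where "\<rho> r = (r / c) powr k" for r
  have "(\<rho> \<longlongrightarrow> (0 / c) powr k) (at_right 0)"
    unfolding \<rho>_def using k c
    by (intro tendsto_powr' tendsto_intros) (auto intro!: eventually_mono[OF eventually_at_right_less])
  then have "(\<rho> \<longlongrightarrow> 0) (at_right 0)" by simp
  moreover have "\<forall>\<^sub>F r in at_right 0. \<rho> r > 0"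
    using eventually_at_right_less[of "0::real"] by eventually_elim (use c in \<open>simp add: \<rho>_def\<close>)
  ultimately have lim: "filterlim \<rho> (at_right 0) (at_right 0)"
    by (auto simp: filterlim_at elim!: eventually_mono)
  have "\<forall>\<^sub>F r in at_right 0. r < \<delta> / 2"
    using \<delta> by (intro order_tendstoD tendsto_ident_at) auto
  with dens have "\<forall>\<^sub>F r in at_right 0. ennreal (s * (2 * r)) \<le> hausdorff_measure 1 (A \<inter> cball t r) \<and> r < \<delta> / 2"
    by (rule eventually_conj)
  then have "\<forall>\<^sub>F r in at_right 0. ennreal (s * (2 * \<rho> r)) \<le> hausdorff_measure 1 (A \<inter> cball t (\<rho> r)) \<and> \<rho> r < \<delta> / 2"
    by (rule eventually_compose_filterlim[OF _ lim])
  then show ?thesis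
    using eventually_at_right_less[of "0::real"]
  proof eventually_elim
    case (elim r)
    then have r: "0 < r" and \<rho>: "\<rho> r < \<delta> / 2"
      and d: "ennreal (s * (2 * \<rho> r)) \<le> hausdorff_measure 1 (A \<inter> cball t (\<rho> r))" by auto
    define D where "D = A \<inter> cball t (\<rho> r)"
    have near: "\<bar>u - v\<bar> < \<delta>" if "u \<in> D" "v \<in> D" for u v
      using that \<rho> by (auto simp: D_def dist_real_def)
    have \<rho>k: "\<rho> r powr (1 / k) = r / c"
      using k r c by (simp add: \<rho>_def powr_powr)
    have "0 < \<rho> r" using r c by (simp add: \<rho>_def)
    have "\<gamma> u \<in> S \<inter> ball (\<gamma> t) r" if u: "u \<in> D" for u
    proof -
      have ut: "\<bar>u - t\<bar> \<le> \<rho> r" using u by (auto simp: D_def dist_real_def)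
      then have "dist (\<gamma> u) (\<gamma> t) \<le> \<theta> * l * \<bar>u - t\<bar> powr (1 / k)"
        using u t \<rho> \<open>0 < \<rho> r\<close> by (intro upper) (auto simp: D_def)
      also have "\<dots> \<le> \<theta> * l * \<rho> r powr (1 / k)"
        using ut k l \<theta> by (intro mult_left_mono powr_mono2) auto
      also have "\<dots> = r / \<theta>"
        using l \<theta> unfolding \<rho>k c_def by (simp add: power2_eq_square)
      also have "\<dots> < r" using r \<theta> by (simp add: field_simps)
      finally show ?thesis using u AS by (auto simp: D_def dist_commute)
    qed
    then have sub: "\<gamma> ` D \<subseteq> S \<inter> ball (\<gamma> t) r" by blast
    have inv: "\<bar>u - v\<bar> \<le> (1 / l) powr k * dist (\<gamma> u) (\<gamma> v) powr k" if uv: "u \<in> D" "v \<in> D" for u v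
    proof -
      have "l * \<bar>u - v\<bar> powr (1 / k) \<le> dist (\<gamma> u) (\<gamma> v)"
        using uv near[OF uv] by (intro lower) (auto simp: D_def)
      then have "\<bar>u - v\<bar> powr (1 / k) \<le> 1 / l * dist (\<gamma> u) (\<gamma> v)"
        using l by (simp add: field_simps)
      then have "(\<bar>u - v\<bar> powr (1 / k)) powr k \<le> (1 / l * dist (\<gamma> u) (\<gamma> v)) powr k"
        using k by (intro powr_mono2) auto
      also have "(\<bar>u - v\<bar> powr (1 / k)) powr k = \<bar>u - v\<bar>" using k by (simp add: powr_powr)
      also have "(1 / l * dist (\<gamma> u) (\<gamma> v)) powr k = (1 / l) powr k * dist (\<gamma> u) (\<gamma> v) powr k"
        by (rule powr_mult)
      finally show ?thesis .
    qed
    have inj: "inj_on \<gamma> D"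
    proof (rule inj_onI)
      fix u v assume "u \<in> D" "v \<in> D" "\<gamma> u = \<gamma> v"
      then show "u = v" using inv[of u v] by simp
    qed
    define f where "f = inv_into D \<gamma>"
    have f: "f (\<gamma> u) = u" if "u \<in> D" for u
      using inj that by (simp add: f_def)
    have fD: "f ` (\<gamma> ` D) = D" using f by force
    have "hausdorff_measure 1 (f ` (\<gamma> ` D))
        \<le> ennreal (((1 / l) powr k) powr 1) * hausdorff_measure (k * 1) (\<gamma> ` D)"
    proof (rule hausdorff_measure_holder_image[where \<delta> = 1])
      fix x y assume "x \<in> \<gamma> ` D" "y \<in> \<gamma> ` D"
      then obtain u v where "u \<in> D" "v \<in> D" "x = \<gamma> u" "y = \<gamma> v" by blast
      then show "dist (f x) (f y) \<le> (1 / l) powr k * dist x y powr k"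
        using inv f by (simp add: dist_real_def)
    qed (use k l in auto)
    then have "hausdorff_measure 1 D \<le> ennreal ((1 / l) powr k) * hausdorff_measure k (\<gamma> ` D)"
      unfolding fD by simp
    also have "\<dots> \<le> ennreal ((1 / l) powr k) * hausdorff_measure k (S \<inter> ball (\<gamma> t) r)"
      using sub by (intro mult_left_mono hausdorff_measure_mono) auto
    finally have "ennreal (s * (2 * \<rho> r)) \<le> ennreal ((1 / l) powr k) * hausdorff_measure k (S \<inter> ball (\<gamma> t) r)"
      using d by (simp add: D_def)
    then have "ennreal (l powr k) * ennreal (s * (2 * \<rho> r))
        \<le> ennreal (l powr k) * (ennreal ((1 / l) powr k) * hausdorff_measure k (S \<inter> ball (\<gamma> t) r))"
      by (rule mult_left_mono) simp
    also have "\<dots> = ennreal (l powr k * (1 / l) powr k) * hausdorff_measure k (S \<inter> ball (\<gamma> t) r)"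
      by (simp add: ennreal_mult mult.assoc)
    also have "l powr k * (1 / l) powr k = 1"
      using l by (simp flip: powr_mult)
    also have "ennreal (l powr k) * ennreal (s * (2 * \<rho> r)) = ennreal (2 * s * (1 / \<theta>\<^sup>2) powr k * r powr k)"
    proof -
      have "l powr k * \<rho> r = (1 / \<theta>\<^sup>2) powr k * r powr k"
      proof -
        have "l * (r / c) = 1 / \<theta>\<^sup>2 * r" using l by (simp add: c_def)
        then show ?thesis unfolding \<rho>_def by (metis powr_mult)
      qed
      then have "l powr k * (s * (2 * \<rho> r)) = 2 * s * (1 / \<theta>\<^sup>2) powr k * r powr k"
        by (simp add: algebra_simps)
      then show ?thesis using s \<open>0 < \<rho> r\<close> by (simp flip: ennreal_mult)
    qed
    finally show ?case by simp
  qed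
qed

lemma m_quotient_bounds:
  assumes lim: "(m_quotient k \<gamma> t \<longlongrightarrow> L) (at 0 within {s. t + s \<in> {a..b}})"
  shows "c < L \<Longrightarrow> \<exists>n. \<forall>u\<in>{a..b}. \<bar>u - t\<bar> < 1 / real (Suc n) \<longrightarrow> c * \<bar>u - t\<bar> powr (1 / k) \<le> dist (\<gamma> u) (\<gamma> t)"
    and "L < c \<Longrightarrow> \<exists>n. \<forall>u\<in>{a..b}. \<bar>u - t\<bar> < 1 / real (Suc n) \<longrightarrow> dist (\<gamma> u) (\<gamma> t) \<le> c * \<bar>u - t\<bar> powr (1 / k)"
proof -
  have *: "\<exists>n. \<forall>u\<in>{a..b}. u \<noteq> t \<longrightarrow> \<bar>u - t\<bar> < 1 / real (Suc n) \<longrightarrow> P (m_quotient k \<gamma> t (u - t))"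
    if ev: "\<forall>\<^sub>F s in at 0 within {s. t + s \<in> {a..b}}. P (m_quotient k \<gamma> t s)" for P
  proof -
    obtain d where d: "0 < d" "\<And>s. t + s \<in> {a..b} \<Longrightarrow> s \<noteq> 0 \<Longrightarrow> \<bar>s\<bar> < d \<Longrightarrow> P (m_quotient k \<gamma> t s)"
      using ev by (auto simp: eventually_at dist_real_def)
    obtain n where n: "inverse (real (Suc n)) < d" using reals_Archimedean[OF d(1)] by blast
    have "P (m_quotient k \<gamma> t (u - t))"
      if "u \<in> {a..b}" "u \<noteq> t" "\<bar>u - t\<bar> < 1 / real (Suc n)" for u
      using that n by (intro d(2)) (auto simp: inverse_eq_divide)
    then show ?thesis by blast
  qed
  show "\<exists>n. \<forall>u\<in>{a..b}. \<bar>u - t\<bar> < 1 / real (Suc n) \<longrightarrow> c * \<bar>u - t\<bar> powr (1 / k) \<le> dist (\<gamma> u) (\<gamma> t)" if cL: "c < L"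
  proof -
    obtain n where n: "\<And>u. u \<in> {a..b} \<Longrightarrow> u \<noteq> t \<Longrightarrow> \<bar>u - t\<bar> < 1 / real (Suc n) \<Longrightarrow> c < m_quotient k \<gamma> t (u - t)"
      using *[OF order_tendstoD(1)[OF lim cL]] by blast
    have "c * \<bar>u - t\<bar> powr (1 / k) \<le> dist (\<gamma> u) (\<gamma> t)" if "u \<in> {a..b}" "\<bar>u - t\<bar> < 1 / real (Suc n)" for u
      using n[OF that(1) _ that(2)] by (cases "u = t") (auto simp: m_quotient_def less_divide_eq)
    then show ?thesis by blast
  qed
  show "\<exists>n. \<forall>u\<in>{a..b}. \<bar>u - t\<bar> < 1 / real (Suc n) \<longrightarrow> dist (\<gamma> u) (\<gamma> t) \<le> c * \<bar>u - t\<bar> powr (1 / k)" if cL: "L < c"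
  proof -
    obtain n where n: "\<And>u. u \<in> {a..b} \<Longrightarrow> u \<noteq> t \<Longrightarrow> \<bar>u - t\<bar> < 1 / real (Suc n) \<Longrightarrow> m_quotient k \<gamma> t (u - t) < c"
      using *[OF order_tendstoD(2)[OF lim cL]] by blast
    have "dist (\<gamma> u) (\<gamma> t) \<le> c * \<bar>u - t\<bar> powr (1 / k)" if "u \<in> {a..b}" "\<bar>u - t\<bar> < 1 / real (Suc n)" for u
      using n[OF that(1) _ that(2)] by (cases "u = t") (auto simp: m_quotient_def divide_less_eq)
    then show ?thesis by blast
  qed
qed

lemma m_C1_lower_density:
  fixes \<gamma> :: "real \<Rightarrow> 'a::metric_space"
  assumes k: "0 < k" and \<gamma>: "m_C1 k a b \<gamma>" and c: "c < 2"
  shows "hausdorff_measure k {q \<in> S \<inter> \<gamma> ` {a..b}.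
    \<not> (\<forall>\<^sub>F r in at_right 0. ennreal (c * r powr k) \<le> hausdorff_measure k (S \<inter> ball q r))} = 0"
    (is "hausdorff_measure k ?bad = 0")
proof -
  have "((\<lambda>\<theta>. 2 * (1 / \<theta>) * (1 / \<theta>\<^sup>2) powr k) \<longlongrightarrow> 2 * (1 / 1) * (1 / 1\<^sup>2) powr k) (at_right 1)"
    by (intro tendsto_intros) auto
  then have "\<forall>\<^sub>F \<theta> in at_right 1. c < 2 * (1 / \<theta>) * (1 / \<theta>\<^sup>2) powr k"
    using c by (intro order_tendstoD) auto
  then have "\<forall>\<^sub>F \<theta> in at_right 1. 1 < \<theta> \<and> c < 2 * (1 / \<theta>) * (1 / \<theta>\<^sup>2) powr k"
    using eventually_at_right_less[of "1::real"] by eventually_elim simp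
  then obtain \<theta> :: real where \<theta>: "1 < \<theta>" "c < 2 * (1 / \<theta>) * (1 / \<theta>\<^sup>2) powr k"
    using eventually_happens'[of "at_right (1::real)"] by auto
  define lo where "lo l n t \<longleftrightarrow> (\<forall>u\<in>{a..b}. \<bar>u - t\<bar> < 1 / real (Suc n) \<longrightarrow>
      l * \<bar>u - t\<bar> powr (1 / k) \<le> dist (\<gamma> u) (\<gamma> t))" for l t and n :: nat
  define up where "up l n t \<longleftrightarrow> (\<forall>u\<in>{a..b}. \<bar>u - t\<bar> < 1 / real (Suc n) \<longrightarrow>
      dist (\<gamma> u) (\<gamma> t) \<le> l * \<bar>u - t\<bar> powr (1 / k))" for l t and n :: nat
  define Z where "Z = {t \<in> {a..b}. \<forall>\<epsilon>>0. \<exists>n. up \<epsilon> n t}"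
  define A where "A p = {t \<in> {a..b}. \<gamma> t \<in> S \<and> lo (fst p) (snd p) t \<and> up (\<theta> * fst p) (snd p) t}" for p :: "real \<times> nat"
  define N where "N p = {t \<in> A p. \<exists>\<^sub>F r in at_right 0. hausdorff_measure 1 (A p \<inter> cball t r) < ennreal (1 / \<theta> * (2 * r))}" for p
  define I where "I = (\<rat> \<inter> {0::real<..}) \<times> (UNIV :: nat set)"
  have sub: "?bad \<subseteq> \<gamma> ` Z \<union> (\<Union>p\<in>I. \<gamma> ` N p)"
  proof
    fix q assume q: "q \<in> ?bad"
    then obtain t where t: "t \<in> {a..b}" "q = \<gamma> t" by blast
    obtain L where L: "(m_quotient k \<gamma> t \<longlongrightarrow> L) (at 0 within {s. t + s \<in> {a..b}})"
      using \<gamma> t unfolding m_C1_def m_differentiable_def by blast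
    show "q \<in> \<gamma> ` Z \<union> (\<Union>p\<in>I. \<gamma> ` N p)"
    proof (cases "L \<le> 0")
      case True
      then have "t \<in> Z" using t m_quotient_bounds(2)[OF L] by (auto simp: Z_def up_def)
      then show ?thesis using t by blast
    next
      case False
      then have "L / \<theta> < L" using \<theta> by (simp add: divide_less_eq)
      then obtain l where l: "l \<in> \<rat>" "L / \<theta> < l" "l < L" using Rats_dense_in_real by blast
      have l0: "0 < l" using l(2) False \<theta> divide_pos_pos[of L \<theta>] by linarith
      have "L < \<theta> * l" using l(2) \<theta> by (simp add: divide_less_eq mult.commute)
      then obtain n1 n2 where n1: "lo l n1 t" and n2: "up (\<theta> * l) n2 t"
        using m_quotient_bounds[OF L] l(3) unfolding lo_def up_def by meson
      define n where "n = max n1 n2"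
      have n: "1 / real (Suc n) \<le> 1 / real (Suc n1)" "1 / real (Suc n) \<le> 1 / real (Suc n2)"
        by (simp_all add: n_def field_simps)
      have tA: "t \<in> A (l, n)"
        using n1 n2 n t q unfolding A_def lo_def up_def by fastforce
      have pI: "(l, n) \<in> I" using l l0 by (simp add: I_def)
      have "t \<in> N (l, n)"
      proof (rule ccontr)
        assume "t \<notin> N (l, n)"
        then have dens: "\<forall>\<^sub>F r in at_right 0. ennreal (1 / \<theta> * (2 * r)) \<le> hausdorff_measure 1 (A (l, n) \<inter> cball t r)"
          using tA by (simp add: N_def not_frequently not_less)
        have "\<forall>\<^sub>F r in at_right 0. ennreal (2 * (1 / \<theta>) * (1 / \<theta>\<^sup>2) powr k * r powr k)
            \<le> hausdorff_measure k (S \<inter> ball (\<gamma> t) r)"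
        proof (rule lower_density_at_parameter[OF k l0 \<theta>(1) _ _ tA _ _ _ dens, where \<delta> = "1 / real (Suc n)"])
          show "l * \<bar>u - v\<bar> powr (1 / k) \<le> dist (\<gamma> u) (\<gamma> v)" "dist (\<gamma> u) (\<gamma> v) \<le> \<theta> * l * \<bar>u - v\<bar> powr (1 / k)"
            if "v \<in> A (l, n)" "u \<in> A (l, n)" "\<bar>u - v\<bar> < 1 / real (Suc n)" for u v
            using that unfolding A_def lo_def up_def by auto
        qed (use \<theta> in \<open>auto simp: A_def\<close>)
        then have "\<forall>\<^sub>F r in at_right 0. ennreal (c * r powr k) \<le> hausdorff_measure k (S \<inter> ball q r)"
        proof eventually_elim
          case (elim r)
          have "ennreal (c * r powr k) \<le> ennreal (2 * (1 / \<theta>) * (1 / \<theta>\<^sup>2) powr k * r powr k)"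
            using \<theta>(2) by (intro ennreal_leI mult_right_mono) auto
          also note elim
          finally show ?case using t by simp
        qed
        with q show False by blast
      qed
      then show ?thesis using t pI by blast
    qed
  qed
  have "hausdorff_measure k (\<gamma> ` Z) = 0"
  proof (rule hausdorff_measure_flat_part[OF k])
    show "continuous_on {a..b} \<gamma>" using \<gamma> by (simp add: m_C1_def)
  qed (auto simp: Z_def up_def)
  moreover have "hausdorff_measure k (\<Union>p\<in>I. \<gamma> ` N p) = 0"
  proof (rule hausdorff_measure_null_UN)
    show "countable I" unfolding I_def by (intro countable_SIGMA countable_Int1 countable_rat) auto
    fix p assume p: "p \<in> I"
    have "hausdorff_measure 1 (N p) = 0"
      unfolding N_def using \<theta> by (intro hausdorff_1_lower_density[of _ a b]) (auto simp: A_def)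
    moreover have "hausdorff_measure k (\<gamma> ` N p) \<le> ennreal ((\<theta> * fst p) powr k) * hausdorff_measure 1 (N p)"
    proof (rule hausdorff_measure_holder_image_real[OF k, where \<delta> = "1 / real (Suc (snd p))"])
      show "0 < \<theta> * fst p" using p \<theta> by (auto simp: I_def)
      show "dist (\<gamma> u) (\<gamma> t) \<le> \<theta> * fst p * \<bar>u - t\<bar> powr (1 / k)"
        if "t \<in> N p" "u \<in> N p" "\<bar>u - t\<bar> < 1 / real (Suc (snd p))" for t u
        using that unfolding N_def A_def up_def by auto
    qed simp
    ultimately show "hausdorff_measure k (\<gamma> ` N p) = 0" by simp
  qed
  ultimately have "hausdorff_measure k (\<gamma> ` Z \<union> (\<Union>p\<in>I. \<gamma> ` N p)) = 0"
    using hausdorff_measure_Un[of k "\<gamma> ` Z" "\<Union>p\<in>I. \<gamma> ` N p"] by simp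
  then show ?thesis
    using sub by (rule hausdorff_measure_null_subset)
qed

theorem theorem2:
  fixes S :: "'a::metric_space set" and k :: real
  assumes "k \<ge> 1"
    and "rectifiable_Hk1 k S"
    and "hausdorff_measurable k S"
    and "hausdorff_measure k S < \<infinity>"
  shows "hausdorff_measure k
    {q \<in> S. \<not> (2 \<le> Liminf (at_right 0) (\<lambda>r. hausdorff_measure k (S \<inter> ball q r) / ennreal (r powr k))
        \<and> Liminf (at_right 0) (\<lambda>r. hausdorff_measure k (S \<inter> ball q r) / ennreal (r powr k))
           \<le> Limsup (at_right 0) (\<lambda>r. hausdorff_measure k (S \<inter> ball q r) / ennreal (r powr k))
        \<and> Limsup (at_right 0) (\<lambda>r. hausdorff_measure k (S \<inter> ball q r) / ennreal (r powr k))
           \<le> ennreal (2 powr k))} = 0"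
proof -
  have k: "0 < k" using \<open>k \<ge> 1\<close> by simp
  obtain \<gamma> :: "nat \<Rightarrow> real \<Rightarrow> 'a" and a b where
    \<gamma>: "\<And>i. m_C1 k (a i) (b i) (\<gamma> i)" and
    rest: "hausdorff_measure k (S - (\<Union>i. \<gamma> i ` {a i..b i})) = 0"
    using assms(2) unfolding rectifiable_Hk1_def by blast
  define dens where "dens q r = hausdorff_measure k (S \<inter> ball q r) / ennreal (r powr k)" for q r
  define c where "c m = 2 - 1 / real (Suc m)" for m
  define s where "s m = 1 + 1 / real (Suc m)" for m
  define low where "low p = {q \<in> S \<inter> \<gamma> (fst p) ` {a (fst p)..b (fst p)}.
    \<not> (\<forall>\<^sub>F r in at_right 0. ennreal (c (snd p) * r powr k) \<le> hausdorff_measure k (S \<inter> ball q r))}" for p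
  define high where "high m = {q \<in> S. \<exists>\<^sub>F r in at_right 0.
    ennreal (s m * (2 * r) powr k) < hausdorff_measure k (S \<inter> cball q r)}" for m
  have low: "hausdorff_measure k (\<Union>p. low p) = 0"
    unfolding low_def using k \<gamma> by (intro hausdorff_measure_null_UN m_C1_lower_density) (auto simp: c_def)
  have high: "hausdorff_measure k (\<Union>m. high m) = 0"
    unfolding high_def using k assms(4)
    by (intro hausdorff_measure_null_UN hausdorff_upper_density) (auto simp: s_def)
  have one_over: "(\<lambda>m. 1 / real (Suc m)) \<longlonglongrightarrow> 0"
    using LIMSEQ_inverse_real_of_nat by (simp add: inverse_eq_divide)
  have good: "2 \<le> Liminf (at_right 0) (dens q) \<and> Liminf (at_right 0) (dens q) \<le> Limsup (at_right 0) (dens q)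
      \<and> Limsup (at_right 0) (dens q) \<le> ennreal (2 powr k)"
    if q: "q \<in> S" "q \<in> (\<Union>i. \<gamma> i ` {a i..b i})" "q \<notin> (\<Union>p. low p)" "q \<notin> (\<Union>m. high m)" for q
  proof (intro conjI)
    have "ennreal (c m) \<le> Liminf (at_right 0) (dens q)" for m
    proof (rule Liminf_bounded)
      obtain i where "q \<in> \<gamma> i ` {a i..b i}" using q by blast
      moreover have "q \<notin> low (i, m)" using q by blast
      ultimately have "\<forall>\<^sub>F r in at_right 0. ennreal (c m * r powr k) \<le> hausdorff_measure k (S \<inter> ball q r)"
        using q by (simp add: low_def)
      then show "\<forall>\<^sub>F r in at_right 0. ennreal (c m) \<le> dens q r"
        using eventually_at_right_less[of "0::real"]
      proof eventually_elim
        case (elim r)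
        have "ennreal (c m * r powr k) / ennreal (r powr k) \<le> dens q r"
          unfolding dens_def using elim(1) by (rule divide_right_mono_ennreal)
        moreover have "0 \<le> c m" by (simp add: c_def field_simps)
        ultimately show ?case using elim(2) by (simp add: divide_ennreal)
      qed
    qed
    moreover have "(\<lambda>m. ennreal (c m)) \<longlonglongrightarrow> ennreal (2 - 0)"
      unfolding c_def by (intro tendsto_intros one_over)
    ultimately show "2 \<le> Liminf (at_right 0) (dens q)"
      using LIMSEQ_le_const2[of "\<lambda>m. ennreal (c m)" "ennreal (2 - 0)"] by (simp add: ennreal_numeral)
    show "Liminf (at_right 0) (dens q) \<le> Limsup (at_right 0) (dens q)"
      by (rule Liminf_le_Limsup) simp
    have "Limsup (at_right 0) (dens q) \<le> ennreal (s m * 2 powr k)" for m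
    proof (rule Limsup_bounded)
      have "q \<notin> high m" using q by blast
      then have "\<forall>\<^sub>F r in at_right 0. hausdorff_measure k (S \<inter> cball q r) \<le> ennreal (s m * (2 * r) powr k)"
        using q by (simp add: high_def not_frequently not_less)
      then show "\<forall>\<^sub>F r in at_right 0. dens q r \<le> ennreal (s m * 2 powr k)"
        using eventually_at_right_less[of "0::real"]
      proof eventually_elim
        case (elim r)
        have "hausdorff_measure k (S \<inter> ball q r) \<le> hausdorff_measure k (S \<inter> cball q r)"
          by (intro hausdorff_measure_mono Int_mono ball_subset_cball subset_refl)
        also note elim(1)
        also have "s m * (2 * r) powr k = r powr k * (s m * 2 powr k)"
          by (simp add: powr_mult)
        also have "ennreal \<dots> = ennreal (r powr k) * ennreal (s m * 2 powr k)"
          by (rule ennreal_mult) (auto simp: s_def)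
        finally show ?case
          unfolding dens_def using elim(2) by (subst ennreal_divide_le_iff) auto
      qed
    qed
    moreover have "(\<lambda>m. ennreal (s m * 2 powr k)) \<longlonglongrightarrow> ennreal ((1 + 0) * 2 powr k)"
      unfolding s_def by (intro tendsto_intros one_over)
    ultimately show "Limsup (at_right 0) (dens q) \<le> ennreal (2 powr k)"
      using LIMSEQ_le_const[of "\<lambda>m. ennreal (s m * 2 powr k)" "ennreal ((1 + 0) * 2 powr k)"] by simp
  qed
  let ?null = "(S - (\<Union>i. \<gamma> i ` {a i..b i})) \<union> ((\<Union>p. low p) \<union> (\<Union>m. high m))"
  have "hausdorff_measure k ((\<Union>p. low p) \<union> (\<Union>m. high m)) = 0"
    using hausdorff_measure_Un[of k "\<Union>p. low p" "\<Union>m. high m"] low high by simp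
  then have null: "hausdorff_measure k ?null = 0"
    using hausdorff_measure_Un[of k "S - (\<Union>i. \<gamma> i ` {a i..b i})" "(\<Union>p. low p) \<union> (\<Union>m. high m)"] rest by simp
  show ?thesis
    by (rule hausdorff_measure_null_subset[OF null]) (use good in \<open>unfold dens_def, blast\<close>)
qed

end
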